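(* Let $K=P(q_1,\ldots,q_n)$ be a pretzel knot, with nonzero integers $q_i$. Up to multiplication by a unit $\pm t^j$ of $\mathbb{Z}[t,t^{-1}]$, the Alexander polynomial $\Delta_K(t)$ equals: (i) when $n$ and all $q_i$ are odd, $$ \Delta_K(t)=\frac{1}{2^{n-1}}\sum_{k\ge 0}(t-1)^{2k}(t+1)^{n-1-2k}\sigma_{2k}(q_1,\ldots,q_n), $$ where $\sigma_i(x_1,\ldots,x_n)$ is the $i$-th elementary symmetric polynomial (the sum being over $0\le 2k\le n-1$); (ii) when $q_1$ is even, $n=2p$ is even, and $q_i$ is odd for $i\ge2$, $$ \Delta_K(t)=\Big(\prod_{i=1}^{p}[-q_{2i-1}]_{-t}\prod_{i=1}^{p}[q_{2i}]_{-t}\Big)\Big(\sum_{i=1}^{p}\frac{1}{[q_{2i}]_{-t}}-\sum_{i=1}^{p}\frac{1}{[-q_{2i-1}]_{-t}}\Big); $$ (iii) when $q_1$ is even, $n=2p+1$ is odd, and $q_i$ is odd for $i\ge2$, $$ \Delta_K(t)=\Big(\frac{q_1}{2}[-2]_{-t}\prod_{i=2}^{p+1}[-q_{2i-1}]_{-t}\prod_{i=1}^{p}[q_{2i}]_{-t}\Big)\Big(\sum_{i=1}^{p}\frac{1}{[q_{2i}]_{-t}}-\sum_{i=2}^{p+1}\frac{1}{[-q_{2i-1}]_{-t}}+\frac{2}{q_1}\,\frac{1}{t\,[-2]_{-t}}\Big). $$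
   Context: The pretzel link $P(q_1,\ldots,q_n)$ is obtained by cyclically connecting, at top and bottom, $n$ vertical twisted bands (two-strand twist regions), the $i$-th having $|q_i|$ half twists (crossings), the sign of $q_i$ giving the (unoriented) handedness of the twists; i.e. it is the numerator closure of the sum of the vertical twist tangles $1/[q_1]+\cdots+1/[q_n]$. Replacing all $q_i$ by $-q_i$ gives the mirror image, which has the same Alexander polynomial. $P(q_1,\ldots,q_n)$ is a knot exactly when either exactly one $q_i$ is even, or all $q_i$ and $n$ are odd; in the first case, by cyclic permutation one takes $q_1$ to be the even one. Quantum integers: $[m]_x=\frac{1-x^m}{1-x}\in\mathbb{Z}[x,x^{-1}]$ for $m\in\mathbb{Z}$. The right-hand sides are Laurent polynomials in $t$ (computed in the field of rational functions $\mathbb{Q}(t)$). The Alexander polynomial is defined up to units $\pm t^j$. *)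

theory Defs
  imports
    "HOL-Computational_Algebra.Computational_Algebra"
    "Jordan_Normal_Form.Determinant"
begin

section \<open>Link diagrams\<close>

text \<open>
  An unoriented link diagram, encoded as a planar diagram code.  The edges of a diagram are the
  edges of the underlying 4-valent graph, so an edge ends at every crossing it meets, also where
  it is the over-strand.  At a crossing \<open>c\<close> the under-strand joins the two edges of
  \<open>strand D c Under\<close> and the over-strand joins the two edges of \<open>strand D c Over\<close>.
  The pairs are listed such that the four edge ends in counterclockwise order around \<open>c\<close> are
  \<open>fst (strand D c Under)\<close>, \<open>fst (strand D c Over)\<close>,
  \<open>snd (strand D c Under)\<close>, \<open>snd (strand D c Over)\<close>.
\<close>

datatype level = Under | Over

record ('c, 'e) diagram =
  crossings :: "'c set"
  strand :: "'c \<Rightarrow> level \<Rightarrow> 'e \<times> 'e"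

definition strands :: "('c, 'e) diagram \<Rightarrow> ('c \<times> level) set" where
  "strands D = crossings D \<times> {Under, Over}"

definition edges :: "('c, 'e) diagram \<Rightarrow> 'e set" where
  "edges D = (\<Union>(c, l)\<in>strands D. {fst (strand D c l), snd (strand D c l)})"

text \<open>
  Each edge has exactly two ends.  Realizability in the plane is not part of this predicate (so
  virtual diagrams are admitted); the pretzel diagrams below are planar by construction.
\<close>

definition link_diagram :: "('c, 'e) diagram \<Rightarrow> bool" where
  "link_diagram D \<longleftrightarrow> finite (crossings D) \<and>
     (\<forall>e\<in>edges D. card {(c, l) \<in> strands D. fst (strand D c l) = e}
                + card {(c, l) \<in> strands D. snd (strand D c l) = e} = 2)"

text \<open>
  A diagram represents a knot if all edges lie on one component, i.e. can be reached from one
  another by going straight on at crossings.  (The diagram without crossings has no edges in this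
  encoding and is excluded.)
\<close>

definition straight_on :: "('c, 'e) diagram \<Rightarrow> ('e \<times> 'e) set" where
  "straight_on D = (\<lambda>(c, l). strand D c l) ` strands D"

definition knot_diagram :: "('c, 'e) diagram \<Rightarrow> bool" where
  "knot_diagram D \<longleftrightarrow> link_diagram D \<and> crossings D \<noteq> {} \<and>
     (\<forall>e\<in>edges D. \<forall>e'\<in>edges D. (e, e') \<in> (straight_on D \<union> (straight_on D)\<inverse>)\<^sup>*)"

text \<open>
  An orientation says for every strand whether it runs from the first to the second edge of its
  pair (\<open>True\<close>) or backwards (\<open>False\<close>).  It is consistent if every edge enters exactly one
  crossing strand and leaves exactly one.
\<close>

definition in_edge :: "('c, 'e) diagram \<Rightarrow> ('c \<times> level \<Rightarrow> bool) \<Rightarrow> 'c \<times> level \<Rightarrow> 'e" where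
  "in_edge D \<omega> = (\<lambda>(c, l). if \<omega> (c, l) then fst (strand D c l) else snd (strand D c l))"

definition out_edge :: "('c, 'e) diagram \<Rightarrow> ('c \<times> level \<Rightarrow> bool) \<Rightarrow> 'c \<times> level \<Rightarrow> 'e" where
  "out_edge D \<omega> = (\<lambda>(c, l). if \<omega> (c, l) then snd (strand D c l) else fst (strand D c l))"

definition orientation :: "('c, 'e) diagram \<Rightarrow> ('c \<times> level \<Rightarrow> bool) \<Rightarrow> bool" where
  "orientation D \<omega> \<longleftrightarrow>
     bij_betw (in_edge D \<omega>) (strands D) (edges D) \<and>
     bij_betw (out_edge D \<omega>) (strands D) (edges D)"


section \<open>The Alexander polynomial\<close>

text \<open>
  By the counterclockwise convention, the under-strand edge to the left of the oriented
  over-strand is the first one if the over-strand runs from its first to its second edge, and the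
  second one otherwise.
\<close>

definition left_edge :: "('c, 'e) diagram \<Rightarrow> ('c \<times> level \<Rightarrow> bool) \<Rightarrow> 'c \<Rightarrow> 'e" where
  "left_edge D \<omega> c =
     (if \<omega> (c, Over) then fst (strand D c Under) else snd (strand D c Under))"

definition right_edge :: "('c, 'e) diagram \<Rightarrow> ('c \<times> level \<Rightarrow> bool) \<Rightarrow> 'c \<Rightarrow> 'e" where
  "right_edge D \<omega> c =
     (if \<omega> (c, Over) then snd (strand D c Under) else fst (strand D c Under))"

text \<open>
  The Wirtinger presentation of the link group with one generator \<open>x\<^sub>e\<close> for every edge
  and, for every crossing with over-strand edges \<open>o, o'\<close> and under-strand edges
  \<open>l, r\<close> (left and right of the over-strand), the relations
  \<open>x\<^sub>o = x\<^sub>o\<^sub>'\<close> and \<open>x\<^sub>l = x\<^sub>o x\<^sub>r x\<^sub>o\<inverse>\<close>.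
  Its Alexander matrix consists of the Fox derivatives of these relations after mapping every
  generator to \<open>t\<close>.  Rows are indexed by strands, columns by edges; the entries are written as
  sums because some of the edges at a crossing may coincide.
\<close>

definition alexander_matrix ::
    "('c, 'e) diagram \<Rightarrow> ('c \<times> level \<Rightarrow> bool) \<Rightarrow> 'c \<times> level \<Rightarrow> 'e \<Rightarrow> int poly" where
  "alexander_matrix D \<omega> = (\<lambda>(c, l) e.
     let t = [:0, 1:]; \<delta> = (\<lambda>e'. if e' = e then 1 else 0) in
     case l of
       Over \<Rightarrow> \<delta> (fst (strand D c Over)) - \<delta> (snd (strand D c Over))
     | Under \<Rightarrow> \<delta> (left_edge D \<omega> c) - t * \<delta> (right_edge D \<omega> c)
                - (1 - t) * \<delta> (fst (strand D c Over)))"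

text \<open>
  The minors of order \<open>k\<close> of a matrix with index sets \<open>R\<close> and \<open>C\<close>.  As these sets carry no
  order, each minor occurs for every ordering of its rows and columns, i.e. up to sign.
\<close>

definition minors :: "nat \<Rightarrow> 'r set \<Rightarrow> 'c set \<Rightarrow> ('r \<Rightarrow> 'c \<Rightarrow> 'a::comm_ring_1) \<Rightarrow> 'a set" where
  "minors k R C M =
     {det (mat k k (\<lambda>(i, j). M (rs ! i) (cs ! j))) | rs cs.
        distinct rs \<and> set rs \<subseteq> R \<and> length rs = k \<and>
        distinct cs \<and> set cs \<subseteq> C \<and> length cs = k}"

text \<open>
  The first Alexander polynomial in the sense of Fox: for a presentation with \<open>m\<close> generators, the
  greatest common divisor of the minors of order \<open>m - 1\<close> of its Alexander matrix, i.e. a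
  generator of the smallest principal ideal containing the first elementary ideal.  The gcd may be
  taken in \<open>\<int>[t]\<close> since it is determined in \<open>\<int>[t, t\<inverse>]\<close> only up to units
  \<open>\<plusminus>t\<^sup>j\<close> anyway.
\<close>

definition alexander_polynomial ::
    "('c, 'e) diagram \<Rightarrow> ('c \<times> level \<Rightarrow> bool) \<Rightarrow> int poly" where
  "alexander_polynomial D \<omega> =
     Gcd (minors (card (edges D) - 1) (strands D) (edges D) (alexander_matrix D \<omega>))"


section \<open>Pretzel links\<close>

text \<open>
  The columns are numbered cyclically by \<open>1, \<dots>, n\<close> from left to right, and the crossings of
  column \<open>i\<close> from top to bottom by \<open>0, \<dots>, \<bar>q i\<bar> - 1\<close>.  \<open>Top i\<close> and
  \<open>Bottom i\<close> join column \<open>i\<close> to the next column; \<open>Inner_Left i j\<close> and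
  \<open>Inner_Right i j\<close> are the two edges between the crossings \<open>j - 1\<close> and \<open>j\<close> of
  column \<open>i\<close>.
\<close>

datatype pretzel_edge = Top nat | Bottom nat | Inner_Left nat nat | Inner_Right nat nat

definition previous_column :: "nat \<Rightarrow> nat \<Rightarrow> nat" where
  "previous_column n i = (if i = 1 then n else i - 1)"

definition left_side :: "nat \<Rightarrow> (nat \<Rightarrow> int) \<Rightarrow> nat \<Rightarrow> nat \<Rightarrow> pretzel_edge" where
  "left_side n q i j =
     (if j = 0 then Top (previous_column n i)
      else if j = nat \<bar>q i\<bar> then Bottom (previous_column n i)
      else Inner_Left i j)"

definition right_side :: "nat \<Rightarrow> (nat \<Rightarrow> int) \<Rightarrow> nat \<Rightarrow> nat \<Rightarrow> pretzel_edge" where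
  "right_side n q i j =
     (if j = 0 then Top i else if j = nat \<bar>q i\<bar> then Bottom i else Inner_Right i j)"

text \<open>
  For \<open>q i > 0\<close> the over-strands of column \<open>i\<close> run between lower left and upper right, for
  \<open>q i < 0\<close> between upper left and lower right.  The other convention yields mirror images.
\<close>

definition pretzel :: "nat \<Rightarrow> (nat \<Rightarrow> int) \<Rightarrow> (nat \<times> nat, pretzel_edge) diagram" where
  "pretzel n q =
     \<lparr>crossings = (SIGMA i:{1..n}. {..<nat \<bar>q i\<bar>}),
      strand = (\<lambda>(i, j) l.
        let nw = left_side n q i j; ne = right_side n q i j;
            sw = left_side n q i (j + 1); se = right_side n q i (j + 1)
        in if q i > 0
           then (case l of Under \<Rightarrow> (se, nw) | Over \<Rightarrow> (ne, sw))
           else (case l of Under \<Rightarrow> (sw, ne) | Over \<Rightarrow> (se, nw)))\<rparr>"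


section \<open>Laurent polynomials and rational functions\<close>

definition ratfun_t :: "rat poly fract" where
  "ratfun_t = to_fract [:0, 1:]"

definition ratfun_of_int_poly :: "int poly \<Rightarrow> rat poly fract" where
  "ratfun_of_int_poly f = to_fract (map_poly of_int f)"

text \<open>Equality up to a unit \<open>\<plusminus>t\<^sup>j\<close> of \<open>\<int>[t, t\<inverse>]\<close>.\<close>

definition eq_up_to_unit :: "rat poly fract \<Rightarrow> rat poly fract \<Rightarrow> bool" where
  "eq_up_to_unit f g \<longleftrightarrow> (\<exists>j::int. f = ratfun_t powi j * g \<or> f = - (ratfun_t powi j) * g)"

definition quantum_int :: "int \<Rightarrow> 'a::field \<Rightarrow> 'a" where
  "quantum_int m x = (1 - x powi m) / (1 - x)"

definition elem_sym :: "nat \<Rightarrow> 'i set \<Rightarrow> ('i \<Rightarrow> 'a::comm_semiring_1) \<Rightarrow> 'a" where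
  "elem_sym k I x = (\<Sum>S | S \<subseteq> I \<and> card S = k. \<Prod>i\<in>S. x i)"

end

theory Submission
  imports Defs
begin

text \<open>
  The rows of the Alexander matrix \<open>A\<close> sum to 0, and an Alexander numbering of the regions of the
  diagram gives a linear dependency of the rows with coefficients \<open>\<plusminus>t\<^sup>k\<close>.  Hence all minors of
  corank 1 agree up to units, and the Alexander polynomial can be read off any one of them.

  Colour the edges so that all relations of a column but the last one hold.  If \<open>\<delta>\<close> is the difference
  of the colours of \<open>Top i\<close> and \<open>Top (i - 1)\<close>, then running down column \<open>i\<close> adds \<open>f\<^sub>i \<delta>\<close> to the
  right colour and \<open>g\<^sub>i \<delta>\<close> to the left one.  Eliminating all other edges by a Schur complement with
  a triangular block leaves the relations \<open>f\<^sub>i \<delta>\<^sub>i = g\<^sub>i\<^sub>+\<^sub>1 \<delta>\<^sub>i\<^sub>+\<^sub>1\<close>, a tridiagonal system whose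
  determinant is the sum over \<open>k\<close> of \<open>f\<^sub>1 \<cdots> f\<^sub>k\<^sub>-\<^sub>1 g\<^sub>k\<^sub>+\<^sub>1 \<cdots> g\<^sub>n\<close>.

  In a column whose strands run in parallel, \<open>g\<^sub>i = [q\<^sub>i]\<^sub>z\<close> and \<open>f\<^sub>i = z g\<^sub>i\<close> where \<open>z\<close> is \<open>-t\<close> or
  \<open>-1/t\<close>, alternating from column to column.  In an antiparallel column, with \<open>T\<close> either \<open>t\<close> or
  \<open>1/t\<close>, \<open>f\<^sub>i\<close> and \<open>g\<^sub>i\<close> equal \<open>(q\<^sub>i (1 - T) \<mp> (1 + T)) / 2\<close> for odd \<open>q\<^sub>i\<close> and \<open>q\<^sub>i (1 - T) / 2\<close>
  for even \<open>q\<^sub>i\<close>.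
\<close>

section \<open>Determinants of submatrices\<close>

text \<open>The index sets of a diagram carry no order, so rows and columns are selected by lists;
  reordering costs only a sign. The size is read off \<open>rs\<close> alone, hence the length
  assumptions below.\<close>

definition sdet :: "('r \<Rightarrow> 'c \<Rightarrow> 'a::comm_ring_1) \<Rightarrow> 'r list \<Rightarrow> 'c list \<Rightarrow> 'a" where
  "sdet M rs cs = det (mat (length rs) (length rs) (\<lambda>(i, j). M (rs ! i) (cs ! j)))"

lemma sdet_transpose:
  assumes "length rs = length cs"
  shows "sdet (\<lambda>c r. M r c) cs rs = sdet M rs cs"
proof -
  have "mat (length cs) (length cs) (\<lambda>(i, j). M (rs ! j) (cs ! i)) =
      transpose_mat (mat (length rs) (length rs) (\<lambda>(i, j). M (rs ! i) (cs ! j)))"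
    using assms by (intro eq_matI) auto
  then show ?thesis
    unfolding sdet_def by (metis det_transpose mat_carrier)
qed

lemma sdet_permute_rows:
  fixes M :: "'r \<Rightarrow> 'c \<Rightarrow> 'a::comm_ring_1"
  assumes "distinct rs" "distinct rs'" "set rs = set rs'"
  shows "sdet M rs cs = sdet M rs' cs \<or> sdet M rs cs = - sdet M rs' cs"
proof -
  have "mset rs = mset rs'"
    using assms set_eq_iff_mset_eq_distinct by blast
  then obtain p where p: "p permutes {..<length rs'}" "permute_list p rs' = rs"
    using mset_eq_permutation by blast
  have len: "length rs = length rs'" using p by auto
  have nth: "rs ! i = rs' ! p i" if "i < length rs'" for i
    using that p permute_list_nth by blast
  have perm: "p permutes {0..<length rs'}" using p by (simp add: lessThan_atLeast0)
  then have lt: "p i < length rs'" if "i < length rs'" for i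
    using that permutes_in_image[OF perm, of i] by simp
  let ?A = "mat (length rs') (length rs') (\<lambda>(i, j). M (rs' ! i) (cs ! j))"
  have "mat (length rs') (length rs') (\<lambda>(i, j). M (rs ! i) (cs ! j)) =
      mat (length rs') (length rs') (\<lambda>(i, j). ?A $$ (p i, j))"
    using lt nth by (intro eq_matI) auto
  then have "sdet M rs cs = of_int (sign p) * det ?A"
    unfolding sdet_def len using det_permute_rows[OF _ perm, of ?A] by simp
  then show ?thesis
    unfolding sdet_def by (cases p rule: sign_cases) auto
qed

lemma sdet_permute_cols:
  fixes M :: "'r \<Rightarrow> 'c \<Rightarrow> 'a::comm_ring_1"
  assumes "distinct cs" "distinct cs'" "set cs = set cs'" "length rs = length cs"
  shows "sdet M rs cs = sdet M rs cs' \<or> sdet M rs cs = - sdet M rs cs'"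
  using sdet_permute_rows[OF assms(1-3), of "\<lambda>c r. M r c" rs] assms
    sdet_transpose[of rs cs M] sdet_transpose[of rs cs' M]
  by (metis distinct_card)

lemma sdet_hom:
  assumes "comm_ring_hom h"
  shows "h (sdet M rs cs) = sdet (\<lambda>r c. h (M r c)) rs cs"
proof -
  interpret comm_ring_hom h by fact
  show ?thesis
    unfolding sdet_def hom_det[symmetric]
    by (intro arg_cong[of _ _ det] eq_matI) auto
qed

text \<open>Cramer's rule: weighting the columns \<open>cs\<close> by \<open>u\<close> gives
  \<open>- u c\<close> times the omitted column \<open>c\<close>. This vector can be put into place
  \<open>k\<close> of either matrix, and the two matrices agree in all other places.\<close>

lemma sdet_exchange_col:
  fixes M :: "'r \<Rightarrow> 'c \<Rightarrow> 'a::idom"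
  assumes fin: "finite C" and cs: "distinct cs" "set cs = C - {c}" "c \<in> C" "length rs = length cs"
    and k: "k < length cs"
    and ker: "\<And>r. r \<in> set rs \<Longrightarrow> (\<Sum>c\<in>C. M r c * u c) = 0"
  shows "u (cs ! k) * sdet M rs cs = - u c * sdet M rs (cs[k := c])"
proof -
  let ?n = "length rs"
  let ?A = "mat ?n ?n (\<lambda>(i, j). M (rs ! i) (cs ! j))"
  let ?B = "mat ?n ?n (\<lambda>(i, j). M (rs ! i) (cs[k := c] ! j))"
  let ?x = "vec ?n (\<lambda>j. u (cs ! j))"
  let ?y = "vec ?n (\<lambda>j. if j = k then - u c else 0)"
  have "replace_col ?A (?A *\<^sub>v ?x) k = replace_col ?B (?B *\<^sub>v ?y) k"
  proof (rule eq_matI)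
    fix i j assume "i < dim_row (replace_col ?B (?B *\<^sub>v ?y) k)"
      "j < dim_col (replace_col ?B (?B *\<^sub>v ?y) k)"
    then have i: "i < ?n" and j: "j < ?n" by (auto simp: replace_col_def)
    have "(\<Sum>j<?n. M (rs ! i) (cs ! j) * u (cs ! j)) = (\<Sum>d\<in>set cs. M (rs ! i) d * u d)"
      using cs by (intro sum.reindex_bij_betw[where h = "\<lambda>j. cs ! j"] bij_betw_nth) auto
    also have "\<dots> = - (M (rs ! i) c * u c)"
      using ker[OF nth_mem[OF i]] fin cs by (simp add: sum.remove[of C c] eq_neg_iff_add_eq_0 add.commute)
    finally have 1: "(\<Sum>j<?n. M (rs ! i) (cs ! j) * u (cs ! j)) = - (M (rs ! i) c * u c)" .
    have 2: "(\<Sum>j<?n. M (rs ! i) (cs[k := c] ! j) * (if j = k then - u c else 0))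
        = - (M (rs ! i) c * u c)"
      using k cs(4) by (subst sum.remove[of _ k]) auto
    show "replace_col ?A (?A *\<^sub>v ?x) k $$ (i, j) = replace_col ?B (?B *\<^sub>v ?y) k $$ (i, j)"
      using i j 1 2 cs(4) k
      by (auto simp: replace_col_def scalar_prod_def lessThan_atLeast0 nth_list_update)
  qed (auto simp: replace_col_def)
  moreover have "det (replace_col ?A (?A *\<^sub>v ?x) k) = u (cs ! k) * det ?A"
    using k cs(4) by (subst cramer_lemma_mat[of _ ?n]) auto
  moreover have "det (replace_col ?B (?B *\<^sub>v ?y) k) = - u c * det ?B"
    using k cs(4) by (subst cramer_lemma_mat[of _ ?n]) auto
  ultimately show ?thesis by (simp add: sdet_def)
qed

text \<open>Exchanging \<open>c'\<close> for \<open>c\<close> in \<open>cs\<close> gives an ordering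
  of \<open>C - {c'}\<close>. So the maximal minors are proportional, up to sign, to the entries of
  a kernel vector; the cross-multiplied form allows entries of \<open>u\<close> to vanish.\<close>

lemma sdet_kernel_cols:
  fixes M :: "'r \<Rightarrow> 'c \<Rightarrow> 'a::idom"
  assumes fin: "finite C"
    and cs: "distinct cs" "set cs = C - {c}" "c \<in> C"
    and cs': "distinct cs'" "set cs' = C - {c'}" "c' \<in> C"
    and len: "length rs = length cs"
    and ker: "\<And>r. r \<in> set rs \<Longrightarrow> (\<Sum>c\<in>C. M r c * u c) = 0"
  shows "u c' * sdet M rs cs = u c * sdet M rs cs' \<or> u c' * sdet M rs cs = - (u c * sdet M rs cs')"
proof (cases "c = c'")
  case True
  have "sdet M rs cs = sdet M rs cs' \<or> sdet M rs cs = - sdet M rs cs'"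
    using cs(1,2) cs'(1,2) len True by (intro sdet_permute_cols) simp_all
  then show ?thesis unfolding True by (metis mult_minus_right)
next
  case False
  then have "c' \<in> set cs" using cs cs' by auto
  then obtain k where k: "k < length cs" "cs ! k = c'" by (auto simp: in_set_conv_nth)
  have "distinct (cs[k := c])" "set (cs[k := c]) = C - {c'}"
    using cs k False cs'(3) by (auto simp: distinct_list_update set_update_distinct)
  then have "sdet M rs (cs[k := c]) = sdet M rs cs' \<or> sdet M rs (cs[k := c]) = - sdet M rs cs'"
    using cs' len by (intro sdet_permute_cols) auto
  then show ?thesis
    using sdet_exchange_col[OF fin cs len k(1) ker] k(2) by auto
qed

lemma sdet_kernel_rows:
  fixes M :: "'r \<Rightarrow> 'c \<Rightarrow> 'a::idom"
  assumes fin: "finite R"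
    and rs: "distinct rs" "set rs = R - {r}" "r \<in> R"
    and rs': "distinct rs'" "set rs' = R - {r'}" "r' \<in> R"
    and len: "length rs = length cs"
    and ker: "\<And>c. c \<in> set cs \<Longrightarrow> (\<Sum>r\<in>R. v r * M r c) = 0"
  shows "v r' * sdet M rs cs = v r * sdet M rs' cs \<or> v r' * sdet M rs cs = - (v r * sdet M rs' cs)"
proof -
  have "length rs' = length rs"
    using fin rs rs' by (metis card_Diff_singleton distinct_card)
  then show ?thesis
    using sdet_kernel_cols[OF fin rs rs', of cs "\<lambda>c r. M r c" v] len ker
      sdet_transpose[of rs cs M] sdet_transpose[of rs' cs M]
    by (simp add: mult.commute)
qed

text \<open>\<open>p r\<close> is the pivot column of row \<open>r\<close>. Sorting the rows by
  \<open>h\<close> makes the matrix lower triangular; ties are harmless because \<open>tri\<close>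
  forces the mutual entries of different rows of equal height to vanish.\<close>

lemma sdet_triangular:
  fixes M :: "'r \<Rightarrow> 'c \<Rightarrow> 'a::idom" and h :: "'r \<Rightarrow> nat"
  assumes "finite R" and "inj_on p R"
    and tri: "\<And>r s. r \<in> R \<Longrightarrow> s \<in> R \<Longrightarrow> M r (p s) \<noteq> 0 \<Longrightarrow> r = s \<or> h s < h r"
  obtains rs where "distinct rs" "set rs = R" "sdet M rs (map p rs) = (\<Prod>r\<in>R. M r (p r))"
proof -
  obtain rs where rs: "set rs = R" "distinct rs"
    using \<open>finite R\<close> finite_distinct_list by blast
  define xs where "xs = sort_key h rs"
  have xs: "set xs = R" "distinct xs" "sorted (map h xs)"
    using rs by (auto simp: xs_def)
  let ?A = "mat (length xs) (length xs) (\<lambda>(i, j). M (xs ! i) (map p xs ! j))"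
  have "?A $$ (i, j) = 0" if "i < j" "j < length xs" for i j
  proof (rule ccontr)
    assume "?A $$ (i, j) \<noteq> 0"
    then have "M (xs ! i) (p (xs ! j)) \<noteq> 0" using that by simp
    then have "xs ! i = xs ! j \<or> h (xs ! j) < h (xs ! i)"
      using that xs by (intro tri) auto
    moreover have "h (xs ! i) \<le> h (xs ! j)"
      using xs(3) that by (auto simp: sorted_iff_nth_mono_less)
    ultimately show False using that xs by (auto simp: nth_eq_iff_index_eq)
  qed
  then have "det ?A = prod_list (diag_mat ?A)"
    by (rule det_lower_triangular) auto
  also have "\<dots> = (\<Prod>i<length xs. M (xs ! i) (p (xs ! i)))"
    by (simp add: prod_list_diag_prod lessThan_atLeast0)
  also have "\<dots> = (\<Prod>r\<in>set xs. M r (p r))"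
    using xs by (intro prod.reindex_bij_betw[where h = "\<lambda>j. xs ! j"] bij_betw_nth) auto
  finally show ?thesis using that[of xs] xs by (simp add: sdet_def)
qed

text \<open>A Schur complement: \<open>X c d\<close> expresses the variable \<open>c\<close> of the first block of columns, as
  determined by the first block of rows, through the variables \<open>d\<close> of the second block.\<close>

lemma sdet_append:
  fixes M :: "'r \<Rightarrow> 'c \<Rightarrow> 'a::idom"
  assumes len: "length rs = length cs" "length rs' = length cs'" and "distinct cs"
    and elim: "\<And>r d. r \<in> set rs \<Longrightarrow> d \<in> set cs' \<Longrightarrow> M r d + (\<Sum>c\<in>set cs. M r c * X c d) = 0"
  shows "sdet M (rs @ rs') (cs @ cs') =
    sdet M rs cs * sdet (\<lambda>r d. M r d + (\<Sum>c\<in>set cs. M r c * X c d)) rs' cs'"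
proof -
  let ?n = "length cs" and ?m = "length cs'"
  define A where "A = mat ?n ?n (\<lambda>(i, j). M (rs ! i) (cs ! j))"
  define B where "B = mat ?n ?m (\<lambda>(i, j). M (rs ! i) (cs' ! j))"
  define C where "C = mat ?m ?n (\<lambda>(i, j). M (rs' ! i) (cs ! j))"
  define D where "D = mat ?m ?m (\<lambda>(i, j). M (rs' ! i) (cs' ! j))"
  define Y where "Y = mat ?n ?m (\<lambda>(i, j). X (cs ! i) (cs' ! j))"
  note carr = A_def B_def C_def D_def Y_def
  have sum: "(\<Sum>i<?n. M r (cs ! i) * X (cs ! i) d) = (\<Sum>c\<in>set cs. M r c * X c d)" for r d
    using \<open>distinct cs\<close> by (intro sum.reindex_bij_betw[where h = "\<lambda>j. cs ! j"] bij_betw_nth) auto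
  have 1: "mat (?n + ?m) (?n + ?m) (\<lambda>(i, j). M ((rs @ rs') ! i) ((cs @ cs') ! j)) = four_block_mat A B C D"
    using len by (intro eq_matI) (auto simp: carr nth_append)
  have 2: "A * Y + B = 0\<^sub>m ?n ?m"
  proof (rule eq_matI)
    fix i j assume "i < dim_row (0\<^sub>m ?n ?m)" "j < dim_col (0\<^sub>m ?n ?m)"
    then have i: "i < ?n" and j: "j < ?m" by auto
    have "M (rs ! i) (cs' ! j) + (\<Sum>k<?n. M (rs ! i) (cs ! k) * X (cs ! k) (cs' ! j)) = 0"
      unfolding sum using i j len by (intro elim) auto
    then show "(A * Y + B) $$ (i, j) = 0\<^sub>m ?n ?m $$ (i, j)"
      using i j len by (simp add: carr scalar_prod_def lessThan_atLeast0 add.commute)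
  qed (auto simp: carr)
  have 3: "C * Y + D = mat ?m ?m (\<lambda>(i, j). M (rs' ! i) (cs' ! j) + (\<Sum>c\<in>set cs. M (rs' ! i) c * X c (cs' ! j)))"
    unfolding sum[symmetric]
    by (intro eq_matI) (auto simp: carr scalar_prod_def lessThan_atLeast0 add.commute)
  \<comment> \<open>Right multiplication by a unipotent block matrix adds
    \<open>Y\<close>-combinations of the first block of columns to the second one and clears the
    upper right block.\<close>
  have "four_block_mat A B C D * four_block_mat (1\<^sub>m ?n) Y (0\<^sub>m ?m ?n) (1\<^sub>m ?m) =
      four_block_mat A (A * Y + B) C (C * Y + D)"
    by (subst mult_four_block_mat[of _ ?n ?n _ ?m _ ?m _ _ ?n _ ?m]) (auto simp: carr)
  then have "det (four_block_mat A B C D) * det (four_block_mat (1\<^sub>m ?n) Y (0\<^sub>m ?m ?n) (1\<^sub>m ?m)) =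
      det (four_block_mat A (A * Y + B) C (C * Y + D))"
    by (subst det_mult[of _ "?n + ?m", symmetric]) (auto simp: carr)
  moreover have "det (four_block_mat (1\<^sub>m ?n) Y (0\<^sub>m ?m ?n) (1\<^sub>m ?m)) = 1"
    by (subst det_four_block_mat_lower_left_zero[of _ ?n _ ?m]) (auto simp: carr)
  moreover have "det (four_block_mat A (A * Y + B) C (C * Y + D)) = det A * det (C * Y + D)"
    unfolding 2 by (subst det_four_block_mat_upper_right_zero[of _ ?n _ ?m]) (auto simp: carr)
  ultimately show ?thesis
    using len 1 3 by (simp add: sdet_def A_def)
qed

section \<open>Tridiagonal determinants\<close>

definition tridiagonal :: "(nat \<Rightarrow> 'a) \<Rightarrow> (nat \<Rightarrow> 'a) \<Rightarrow> (nat \<Rightarrow> 'a) \<Rightarrow> nat \<Rightarrow> nat \<Rightarrow> 'a::zero" where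
  "tridiagonal a b c i j = (if i = j then a i else if j = Suc i then b i else if i = Suc j then c i else 0)"

text \<open>The continuant recurrence, by Laplace expansion along the last row, where at most two
  entries are nonzero.\<close>

lemma sdet_tridiagonal:
  fixes a b c :: "nat \<Rightarrow> 'a::idom"
  shows "sdet (tridiagonal a b c) [0..<Suc (Suc k)] [0..<Suc (Suc k)] =
    a (Suc k) * sdet (tridiagonal a b c) [0..<Suc k] [0..<Suc k]
    - c (Suc k) * b k * sdet (tridiagonal a b c) [0..<k] [0..<k]"
proof -
  define A where "A = mat (Suc (Suc k)) (Suc (Suc k)) (\<lambda>(i, j). tridiagonal a b c i j)"
  have s: "sdet (tridiagonal a b c) [0..<m] [0..<m] = det (mat m m (\<lambda>(i, j). tridiagonal a b c i j))" for m
    unfolding sdet_def by (intro arg_cong[of _ _ det] eq_matI) auto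
  have "det A = (\<Sum>j<Suc (Suc k). A $$ (Suc k, j) * cofactor A (Suc k) j)"
    by (rule laplace_expansion_row) (auto simp: A_def)
  also have "\<dots> = A $$ (Suc k, k) * cofactor A (Suc k) k + A $$ (Suc k, Suc k) * cofactor A (Suc k) (Suc k)"
    by (auto simp: A_def tridiagonal_def)
  also have "cofactor A (Suc k) (Suc k) = det (mat (Suc k) (Suc k) (\<lambda>(i, j). tridiagonal a b c i j))"
    unfolding cofactor_def mat_delete_def by (auto simp: A_def intro!: arg_cong[of _ _ det])
  \<comment> \<open>Only \<open>b k\<close> can be nonzero in the last column of this submatrix, so
    a second expansion returns to the leading block of size \<open>k\<close>.\<close>
  also have "cofactor A (Suc k) k = - (b k * det (mat k k (\<lambda>(i, j). tridiagonal a b c i j)))"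
  proof -
    define B where "B = mat_delete A (Suc k) k"
    have B: "B \<in> carrier_mat (Suc k) (Suc k)" by (auto simp: B_def A_def mat_delete_def)
    have "det B = (\<Sum>i<Suc k. B $$ (i, k) * cofactor B i k)"
      by (rule laplace_expansion_column[OF B]) auto
    also have "\<dots> = B $$ (k, k) * cofactor B k k"
      by (auto simp: B_def A_def mat_delete_def tridiagonal_def)
    also have "cofactor B k k = det (mat k k (\<lambda>(i, j). tridiagonal a b c i j))"
      unfolding cofactor_def mat_delete_def by (auto simp: B_def A_def mat_delete_def intro!: arg_cong[of _ _ det])
    finally have "det B = b k * det (mat k k (\<lambda>(i, j). tridiagonal a b c i j))"
      by (simp add: B_def A_def mat_delete_def tridiagonal_def)
    then show ?thesis by (simp add: cofactor_def B_def)
  qed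
  moreover have "A $$ (Suc k, k) = c (Suc k)" "A $$ (Suc k, Suc k) = a (Suc k)"
    by (simp_all add: A_def tridiagonal_def)
  ultimately show ?thesis
    unfolding s A_def[symmetric] by simp
qed

text \<open>Each summand omits one column, with factors \<open>f\<close> before it and factors
  \<open>g\<close> after it. Neither \<open>g 1\<close> nor \<open>f n\<close> contributes to the
  value at \<open>n\<close>, since the cycle of columns is cut open there.\<close>

primrec chain_sum :: "(nat \<Rightarrow> 'a) \<Rightarrow> (nat \<Rightarrow> 'a) \<Rightarrow> nat \<Rightarrow> 'a::comm_ring_1" where
  "chain_sum f g 0 = 0"
| "chain_sum f g (Suc n) = g (Suc n) * chain_sum f g n + (\<Prod>i=1..n. f i)"

text \<open>The row factors \<open>u i\<close> come out. In the recurrence the terms with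
  \<open>f (n + 2)\<close> combine to \<open>f (n + 2) * (chain_sum f g (n + 2) - g (n + 2) *
  chain_sum f g (n + 1))\<close>, which is the product of \<open>f 1\<close> up to
  \<open>f (n + 2)\<close>.\<close>

lemma sdet_chain:
  fixes f g u :: "nat \<Rightarrow> 'a::idom"
  shows "sdet (tridiagonal (\<lambda>i. u i * (f (i + 1) + g (i + 2))) (\<lambda>i. - (u i * g (i + 2))) (\<lambda>i. - (u i * f (i + 1))))
      [0..<k] [0..<k] = (\<Prod>i<k. u i) * chain_sum f g (Suc k)"
proof (induction k rule: induct_nat_012)
  case 0
  show ?case by (simp add: sdet_def det_dim_zero)
next
  case 1
  show ?case by (simp add: sdet_def det_single tridiagonal_def algebra_simps numeral_2_eq_2)
next
  case (ge2 n)
  show ?case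
    unfolding sdet_tridiagonal ge2 by (simp add: algebra_simps numeral_2_eq_2)
qed

section \<open>The dependency of the Wirtinger relations\<close>

abbreviation t_poly :: "int poly" where "t_poly \<equiv> [:0, 1:]"

lemma alexander_matrix_Over:
  "alexander_matrix D \<omega> (c, Over) e =
    of_bool (fst (strand D c Over) = e) - of_bool (snd (strand D c Over) = e)"
  by (simp add: alexander_matrix_def)

lemma alexander_matrix_Under:
  "alexander_matrix D \<omega> (c, Under) e =
    of_bool (left_edge D \<omega> c = e) - t_poly * of_bool (right_edge D \<omega> c = e)
    - (1 - t_poly) * of_bool (fst (strand D c Over) = e)"
  by (simp add: alexander_matrix_def)

lemma strand_edges:
  assumes "c \<in> crossings D"
  shows "fst (strand D c l) \<in> edges D" "snd (strand D c l) \<in> edges D"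
    "left_edge D \<omega> c \<in> edges D" "right_edge D \<omega> c \<in> edges D"
  using assms by (cases l; force simp: edges_def strands_def left_edge_def right_edge_def)+

lemma finite_strands: "finite (crossings D) \<Longrightarrow> finite (strands D)"
  by (simp add: strands_def)

lemma finite_edges: "finite (crossings D) \<Longrightarrow> finite (edges D)"
  by (auto simp: edges_def intro: finite_strands)

text \<open>A row of the Alexander matrix applied to a vector \<open>x\<close> of edge colours, over
  any ring with a chosen \<open>t\<close>; \<open>x\<close> is an Alexander colouring when all
  defects vanish. Coinciding edges need no separate treatment in this form.\<close>

definition colouring_defect ::
    "'a::comm_ring_1 \<Rightarrow> ('c, 'e) diagram \<Rightarrow> ('c \<times> level \<Rightarrow> bool) \<Rightarrow> ('e \<Rightarrow> 'a) \<Rightarrow> 'c \<times> level \<Rightarrow> 'a" where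
  "colouring_defect t D \<omega> x = (\<lambda>(c, l). case l of
     Over \<Rightarrow> x (fst (strand D c Over)) - x (snd (strand D c Over))
   | Under \<Rightarrow> x (left_edge D \<omega> c) - t * x (right_edge D \<omega> c) - (1 - t) * x (fst (strand D c Over)))"

lemma sum_alexander_matrix:
  assumes "comm_ring_hom h" and fin: "finite (crossings D)" and s: "s \<in> strands D"
  shows "(\<Sum>e\<in>edges D. h (alexander_matrix D \<omega> s e) * x e) = colouring_defect (h t_poly) D \<omega> x s"
proof -
  interpret comm_ring_hom h by fact
  obtain c l where [simp]: "s = (c, l)" by force
  have c: "c \<in> crossings D" using s by (simp add: strands_def)
  have fin: "finite (edges D)" using fin by (rule finite_edges)
  obtain t where t: "t_poly = t" by blast
  have h: "h (of_bool b) = of_bool b" for b by (cases b) (auto simp: hom_zero hom_one)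
  have sum: "(\<Sum>e\<in>edges D. of_bool (e' = e) * x e) = x e'" if "e' \<in> edges D" for e'
    using that fin by (simp add: of_bool_def if_distrib[of "\<lambda>a. a * _"] cong: if_cong)
  show ?thesis
  proof (cases l)
    case Over
    then show ?thesis
      using strand_edges[OF c]
      by (simp add: alexander_matrix_Over colouring_defect_def hom_minus h
        left_diff_distrib sum_subtractf sum)
  next
    case Under
    have "h (alexander_matrix D \<omega> s e) * x e = of_bool (left_edge D \<omega> c = e) * x e
        - h t_poly * (of_bool (right_edge D \<omega> c = e) * x e)
        - (1 - h t_poly) * (of_bool (fst (strand D c Over) = e) * x e)" for e
      using Under by (simp add: alexander_matrix_Under hom_minus hom_mult hom_one hom_add h t algebra_simps)
    then show ?thesis
      using strand_edges[OF c] Under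
      by (simp add: colouring_defect_def sum_subtractf sum flip: sum_distrib_left)
  qed
qed

text \<open>The constant colouring satisfies every Wirtinger relation.\<close>

lemma alexander_matrix_row_sum:
  assumes "finite (crossings D)" "s \<in> strands D"
  shows "(\<Sum>e\<in>edges D. alexander_matrix D \<omega> s e) = 0"
proof -
  have "comm_ring_hom (\<lambda>p::int poly. p)" by unfold_locales auto
  from sum_alexander_matrix[OF this assms, of \<omega> "\<lambda>_. 1"] show ?thesis
    by (auto simp: colouring_defect_def split: prod.splits level.splits)
qed

text \<open>\<open>\<kappa> e\<close> is the index of the region to the left of the edge \<open>e\<close>, where the index grows by one
  whenever an edge is crossed from its left to its right side.\<close>

definition alexander_numbering ::
    "('c, 'e) diagram \<Rightarrow> ('c \<times> level \<Rightarrow> bool) \<Rightarrow> ('e \<Rightarrow> nat) \<Rightarrow> bool" where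
  "alexander_numbering D \<omega> \<kappa> \<longleftrightarrow> (\<forall>c\<in>crossings D.
     \<kappa> (right_edge D \<omega> c) = Suc (\<kappa> (left_edge D \<omega> c)) \<and>
     (if \<omega> (c, Under) = \<omega> (c, Over)
      then \<kappa> (in_edge D \<omega> (c, Over)) = Suc (\<kappa> (left_edge D \<omega> c)) \<and>
           \<kappa> (out_edge D \<omega> (c, Over)) = \<kappa> (left_edge D \<omega> c)
      else \<kappa> (in_edge D \<omega> (c, Over)) = \<kappa> (left_edge D \<omega> c) \<and>
           \<kappa> (out_edge D \<omega> (c, Over)) = Suc (\<kappa> (left_edge D \<omega> c))))"

text \<open>With these weights the rows of a crossing contribute \<open>t ^ \<kappa> e\<close> to the column of an edge \<open>e\<close>
  leaving the crossing and \<open>- t ^ \<kappa> e\<close> to that of an edge entering it, so the weighted sum of all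
  rows vanishes.\<close>

definition wirtinger_weight ::
    "('c, 'e) diagram \<Rightarrow> ('c \<times> level \<Rightarrow> bool) \<Rightarrow> ('e \<Rightarrow> nat) \<Rightarrow> 'c \<times> level \<Rightarrow> int poly" where
  "wirtinger_weight D \<omega> \<kappa> = (\<lambda>(c, l). case l of
     Over \<Rightarrow> (if \<omega> (c, Over) then -1 else 1) * t_poly ^ \<kappa> (snd (strand D c Over))
   | Under \<Rightarrow> (if \<omega> (c, Under) = \<omega> (c, Over) then -1 else 1) * t_poly ^ \<kappa> (left_edge D \<omega> c))"

lemma wirtinger_weight_monomial:
  "\<exists>k. wirtinger_weight D \<omega> \<kappa> s = t_poly ^ k \<or> wirtinger_weight D \<omega> \<kappa> s = - (t_poly ^ k)"
  by (auto simp: wirtinger_weight_def split: prod.splits level.splits)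

lemma wirtinger_weight_crossing:
  assumes "alexander_numbering D \<omega> \<kappa>" "c \<in> crossings D"
  shows "(\<Sum>l\<in>{Under, Over}. wirtinger_weight D \<omega> \<kappa> (c, l) * alexander_matrix D \<omega> (c, l) e) =
    (\<Sum>l\<in>{Under, Over}. t_poly ^ \<kappa> e * (of_bool (out_edge D \<omega> (c, l) = e) - of_bool (in_edge D \<omega> (c, l) = e)))"
proof -
  \<comment> \<open>Next to the Kronecker delta the exponent \<open>\<kappa> e\<close> may be
    replaced by \<open>\<kappa> e'\<close>, so only the indices of the edges at this crossing
    matter.\<close>
  obtain f where f: "\<And>e'. of_bool (e' = e) = (f e' :: int poly)"
    and f': "\<And>e'. t_poly ^ \<kappa> e * f e' = t_poly ^ \<kappa> e' * f e'"
    by (rule that[of "\<lambda>e'. of_bool (e' = e)"]) auto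
  obtain t where t: "t_poly = t" by blast
  show ?thesis
    using assms(2) bspec[OF assms(1)[unfolded alexander_numbering_def] assms(2)]
    by (cases "\<omega> (c, Under)"; cases "\<omega> (c, Over)";
        simp add: wirtinger_weight_def alexander_matrix_Over alexander_matrix_Under
          left_edge_def right_edge_def in_edge_def out_edge_def right_diff_distrib f f'[unfolded t] t;
        simp add: algebra_simps)
qed

text \<open>Every edge is the outgoing edge of exactly one strand and the incoming edge of exactly
  one, so its two contributions cancel.\<close>

lemma wirtinger_dependency:
  assumes fin: "finite (crossings D)" and or: "orientation D \<omega>" and num: "alexander_numbering D \<omega> \<kappa>"
    and e: "e \<in> edges D"
  shows "(\<Sum>s\<in>strands D. wirtinger_weight D \<omega> \<kappa> s * alexander_matrix D \<omega> s e) = 0"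
proof -
  have one: "(\<Sum>s\<in>strands D. of_bool (h s = e)) = (1 :: int poly)" if "bij_betw h (strands D) (edges D)" for h
  proof -
    have "(\<Sum>s\<in>strands D. of_bool (h s = e)) = (\<Sum>e'\<in>edges D. of_bool (e' = e) :: int poly)"
      by (rule sum.reindex_bij_betw[OF that])
    also have "\<dots> = 1" using e finite_edges[OF fin] by (simp add: of_bool_def)
    finally show ?thesis .
  qed
  have split: "(\<Sum>s\<in>strands D. F s) = (\<Sum>c\<in>crossings D. \<Sum>l\<in>{Under, Over}. F (c, l))"
    for F :: "'a \<times> level \<Rightarrow> int poly"
    unfolding strands_def by (simp only: sum.cartesian_product case_prod_eta)
  have "(\<Sum>s\<in>strands D. wirtinger_weight D \<omega> \<kappa> s * alexander_matrix D \<omega> s e) =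
      (\<Sum>s\<in>strands D. t_poly ^ \<kappa> e * (of_bool (out_edge D \<omega> s = e) - of_bool (in_edge D \<omega> s = e)))"
    unfolding split by (intro sum.cong refl wirtinger_weight_crossing[OF num])
  also have "\<dots> = 0"
    using or unfolding orientation_def sum_distrib_left[symmetric] sum_subtractf by (simp add: one)
  finally show ?thesis .
qed

text \<open>The indeterminate is prime over the integers, so factors \<open>t_poly\<close> can be
  stripped one at a time from \<open>p\<close> or from its cofactor until a divisor of 1
  remains.\<close>

lemma dvd_power_t_poly:
  assumes "p dvd t_poly ^ k"
  shows "\<exists>j. p = t_poly ^ j \<or> p = - (t_poly ^ j)"
  using assms
proof (induction k arbitrary: p)
  case 0
  then obtain c where "p = [:c:]" "is_unit c" by (auto simp: is_unit_poly_iff)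
  then show ?case by (intro exI[of _ 0]) (auto simp: one_pCons)
next
  case (Suc k)
  then obtain q where q: "t_poly ^ Suc k = p * q" by blast
  have "prime_elem t_poly" by (rule prime_elem_linear_poly) auto
  moreover have "t_poly dvd p * q" unfolding q[symmetric] power_Suc by (rule dvd_triv_left)
  ultimately consider "t_poly dvd p" | "t_poly dvd q" using prime_elem_dvd_multD by blast
  then show ?case
  proof cases
    case 1
    then obtain p' where p': "p = t_poly * p'" by blast
    then have "t_poly ^ k = p' * q" using q by (simp del: mult_pCons_left mult_pCons_right add: mult.assoc)
    then obtain j where "p' = t_poly ^ j \<or> p' = - (t_poly ^ j)" using Suc.IH[of p'] by auto
    then show ?thesis unfolding p' by (intro exI[of _ "Suc j"]) (metis mult_minus_right power_Suc)
  next
    case 2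
    then obtain q' where "q = t_poly * q'" by blast
    then have "t_poly ^ k = p * q'"
      using q by (simp del: mult_pCons_left mult_pCons_right add: mult.left_commute[of p])
    then show ?thesis using Suc.IH[of p] by auto
  qed
qed

text \<open>Exchanging the omitted column costs a sign, as the kernel vector is constant; exchanging
  the omitted row costs a monomial, as the weights are monomials. So the given minor divides a fixed
  power of \<open>t_poly\<close> times the gcd, and the gcd divides the minor.\<close>

theorem alexander_polynomial_minor:
  assumes fin: "finite (crossings D)" and ne: "crossings D \<noteq> {}"
    and or: "orientation D \<omega>" and num: "alexander_numbering D \<omega> \<kappa>"
    and rs: "distinct rs" "set rs \<subseteq> strands D" "length rs = card (edges D) - 1"
    and cs: "distinct cs" "set cs \<subseteq> edges D" "length cs = card (edges D) - 1"
  shows "\<exists>j. sdet (alexander_matrix D \<omega>) rs cs = t_poly ^ j * alexander_polynomial D \<omega> \<or>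
    sdet (alexander_matrix D \<omega>) rs cs = - (t_poly ^ j) * alexander_polynomial D \<omega>"
proof -
  let ?A = "alexander_matrix D \<omega>" and ?m = "minors (card (edges D) - 1) (strands D) (edges D) (alexander_matrix D \<omega>)"
  let ?d = "sdet ?A rs cs" and ?v = "wirtinger_weight D \<omega> \<kappa>"
  have fE: "finite (edges D)" and fS: "finite (strands D)"
    using fin by (auto intro: finite_edges finite_strands)
  have card: "card (edges D) = card (strands D)"
    using or by (auto simp: orientation_def dest: bij_betw_same_card)
  have pos: "card (edges D) > 0"
    unfolding card using fS ne by (auto simp: card_gt_0_iff strands_def)
  have miss: "\<exists>x. set xs = X - {x} \<and> x \<in> X"
    if "distinct xs" "set xs \<subseteq> X" "length xs = card (edges D) - 1" "finite X" "card X = card (edges D)"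
    for xs and X :: "'x set"
  proof -
    have "card (X - set xs) = 1"
      using that pos by (simp add: card_Diff_subset distinct_card)
    then obtain x where "X - set xs = {x}" by (auto simp: card_1_singleton_iff)
    then show ?thesis using that(2) by (intro exI[of _ x]) auto
  qed
  obtain r where r: "set rs = strands D - {r}" "r \<in> strands D" using miss[OF rs fS] card by auto
  obtain c where c: "set cs = edges D - {c}" "c \<in> edges D" using miss[OF cs fE] by auto
  obtain k where k: "?v r = t_poly ^ k \<or> ?v r = - (t_poly ^ k)" using wirtinger_weight_monomial by blast
  \<comment> \<open>The exponent \<open>k\<close> belongs to the row omitted by \<open>rs\<close>
    and is the same for all minors \<open>d\<close>, so the power can be taken out of the
    gcd.\<close>
  have "?d dvd t_poly ^ k * d" if "d \<in> ?m" for d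
  proof -
    from that obtain rs' cs' where d: "d = sdet ?A rs' cs'"
      and rs': "distinct rs'" "set rs' \<subseteq> strands D" "length rs' = card (edges D) - 1"
      and cs': "distinct cs'" "set cs' \<subseteq> edges D" "length cs' = card (edges D) - 1"
      unfolding minors_def sdet_def by auto
    obtain r' where r': "set rs' = strands D - {r'}" "r' \<in> strands D" using miss[OF rs' fS] card by auto
    obtain c' where c': "set cs' = edges D - {c'}" "c' \<in> edges D" using miss[OF cs' fE] by auto
    have "sdet ?A rs' cs = d \<or> sdet ?A rs' cs = - d"
    proof -
      have "(\<Sum>e\<in>edges D. ?A s e * 1) = 0" if "s \<in> set rs'" for s
        using alexander_matrix_row_sum[OF fin, of s \<omega>] rs'(2) that by auto
      from sdet_kernel_cols[OF fE cs(1) c cs'(1) c' _ this] show ?thesis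
        using rs'(3) cs(3) d by simp
    qed
    moreover have "?v r * sdet ?A rs' cs = ?v r' * ?d \<or> ?v r * sdet ?A rs' cs = - (?v r' * ?d)"
      using rs' cs wirtinger_dependency[OF fin or num]
      by (intro sdet_kernel_rows[OF fS rs'(1) r' rs(1) r]) auto
    ultimately have "?v r * d = ?v r' * ?d \<or> ?v r * d = - (?v r' * ?d)"
      by (auto simp: minus_equation_iff)
    then have "?d dvd ?v r * d" by (metis dvd_minus_iff dvd_triv_right)
    then show ?thesis using k by auto
  qed
  then have "?d dvd Gcd ((*) (t_poly ^ k) ` ?m)" by (intro Gcd_greatest) auto
  then have dvd: "?d dvd t_poly ^ k * alexander_polynomial D \<omega>"
    by (simp add: Gcd_mult alexander_polynomial_def)
  have "alexander_polynomial D \<omega> dvd ?d"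
    unfolding alexander_polynomial_def
  proof (rule Gcd_dvd)
    show "?d \<in> ?m" using rs cs unfolding minors_def sdet_def by force
  qed
  then obtain h where h: "?d = alexander_polynomial D \<omega> * h" by blast
  show ?thesis
  \<comment> \<open>A vanishing gcd does not determine the quotient \<open>h\<close>, but then the
    minor vanishes as well.\<close>
  proof (cases "alexander_polynomial D \<omega> = 0")
    case True
    then show ?thesis using h by simp
  next
    case False
    have "alexander_polynomial D \<omega> * h dvd alexander_polynomial D \<omega> * t_poly ^ k"
      using dvd unfolding h by (simp add: mult.commute)
    then have "h dvd t_poly ^ k" using False dvd_mult_cancel_left by blast
    then obtain j where "h = t_poly ^ j \<or> h = - (t_poly ^ j)" using dvd_power_t_poly by blast
    then show ?thesis using h by (intro exI[of _ j]) (auto simp: mult.commute)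
  qed
qed

section \<open>Oriented pretzel diagrams\<close>

locale oriented_pretzel =
  fixes n :: nat and q :: "nat \<Rightarrow> int" and \<omega> :: "(nat \<times> nat) \<times> level \<Rightarrow> bool"
  assumes n: "n \<ge> 1" and q: "\<And>i. i \<in> {1..n} \<Longrightarrow> q i \<noteq> 0"
    and oriented: "orientation (pretzel n q) \<omega>"
begin

abbreviation "D \<equiv> pretzel n q"
abbreviation "prv \<equiv> previous_column n"
abbreviation "L \<equiv> left_side n q"
abbreviation "R \<equiv> right_side n q"

definition height :: "nat \<Rightarrow> nat" where "height i = nat \<bar>q i\<bar>"

text \<open>The strands joining upper left to lower right and upper right to lower left.\<close>

definition main_strand :: "nat \<Rightarrow> nat \<Rightarrow> (nat \<times> nat) \<times> level" where
  "main_strand i j = ((i, j), if q i > 0 then Under else Over)"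

definition anti_strand :: "nat \<Rightarrow> nat \<Rightarrow> (nat \<times> nat) \<times> level" where
  "anti_strand i j = ((i, j), if q i > 0 then Over else Under)"

section \<open>Directions of the strands and the Alexander numbering\<close>

definition main_down :: "nat \<Rightarrow> nat \<Rightarrow> bool" where "main_down i j \<longleftrightarrow> \<not> \<omega> (main_strand i j)"

text \<open>The pair of an anti strand starts at its upper right edge if \<open>q i > 0\<close> and
  at its lower left edge otherwise, while that of a main strand always starts at the lower right
  edge; this decides the negations.\<close>

definition anti_down :: "nat \<Rightarrow> nat \<Rightarrow> bool" where
  "anti_down i j \<longleftrightarrow> (if q i > 0 then \<omega> (anti_strand i j) else \<not> \<omega> (anti_strand i j))"

lemma height_pos: "i \<in> {1..n} \<Longrightarrow> height i > 0"
  using q[of i] by (simp add: height_def)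

lemma prv_in: "i \<in> {1..n} \<Longrightarrow> prv i \<in> {1..n}"
  using n by (auto simp: previous_column_def)

lemma prv_Suc: "i > 0 \<Longrightarrow> prv (Suc i) = i"
  by (auto simp: previous_column_def)

lemma crossings_pretzel: "crossings D = (SIGMA i:{1..n}. {..<height i})"
  by (simp add: pretzel_def height_def)

lemma finite_crossings: "finite (crossings D)"
  by (simp add: crossings_pretzel)

lemma crossings_nonempty: "crossings D \<noteq> {}"
proof -
  have "(1, 0) \<in> crossings D" using n height_pos[of 1] by (auto simp: crossings_pretzel)
  then show ?thesis by auto
qed

lemma strand_pretzel:
  "strand D (i, j) l = (if q i > 0
     then (case l of Under \<Rightarrow> (R i (Suc j), L i j) | Over \<Rightarrow> (R i j, L i (Suc j)))
     else (case l of Under \<Rightarrow> (L i (Suc j), R i j) | Over \<Rightarrow> (R i (Suc j), L i j)))"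
  by (simp add: pretzel_def Let_def)

lemma in_strands:
  assumes "i \<in> {1..n}" "j < height i"
  shows "main_strand i j \<in> strands D" "anti_strand i j \<in> strands D"
  using assms by (auto simp: strands_def crossings_pretzel main_strand_def anti_strand_def)

lemma strands_cases:
  assumes "s \<in> strands D"
  obtains i j where "i \<in> {1..n}" "j < height i" "s = main_strand i j"
    | i j where "i \<in> {1..n}" "j < height i" "s = anti_strand i j"
proof -
  from assms obtain i j l where s: "s = ((i, j), l)" "i \<in> {1..n}" "j < height i"
    by (auto simp: strands_def crossings_pretzel)
  show ?thesis
    by (cases l; cases "q i > 0"; use s that in \<open>simp add: main_strand_def anti_strand_def\<close>)
qed

lemma strand_inject [simp]:
  "main_strand i j = main_strand i' j' \<longleftrightarrow> i = i' \<and> j = j'"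
  "anti_strand i j = anti_strand i' j' \<longleftrightarrow> i = i' \<and> j = j'"
  "main_strand i j \<noteq> anti_strand i' j'" "anti_strand i' j' \<noteq> main_strand i j"
  by (auto simp: main_strand_def anti_strand_def)

lemma ends_main:
  "in_edge D \<omega> (main_strand i j) = (if main_down i j then L i j else R i (Suc j))"
  "out_edge D \<omega> (main_strand i j) = (if main_down i j then R i (Suc j) else L i j)"
  by (auto simp: main_strand_def main_down_def in_edge_def out_edge_def strand_pretzel)

lemma ends_anti:
  "in_edge D \<omega> (anti_strand i j) = (if anti_down i j then R i j else L i (Suc j))"
  "out_edge D \<omega> (anti_strand i j) = (if anti_down i j then L i (Suc j) else R i j)"
  by (auto simp: anti_strand_def anti_down_def in_edge_def out_edge_def strand_pretzel)

lemma in_edge_inject: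
  "s \<in> strands D \<Longrightarrow> s' \<in> strands D \<Longrightarrow> s \<noteq> s' \<Longrightarrow> in_edge D \<omega> s \<noteq> in_edge D \<omega> s'"
  using oriented by (auto simp: orientation_def bij_betw_def dest: inj_onD)

lemma out_edge_inject:
  "s \<in> strands D \<Longrightarrow> s' \<in> strands D \<Longrightarrow> s \<noteq> s' \<Longrightarrow> out_edge D \<omega> s \<noteq> out_edge D \<omega> s'"
  using oriented by (auto simp: orientation_def bij_betw_def dest: inj_onD)

text \<open>Each edge between consecutive crossings joins a main strand and an anti strand. If these
  disagreed in direction, the edge would enter both or leave both.\<close>

lemma down_Suc:
  assumes "i \<in> {1..n}" "Suc j < height i"
  shows "main_down i (Suc j) \<longleftrightarrow> anti_down i j" "anti_down i (Suc j) \<longleftrightarrow> main_down i j"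
proof -
  have s: "main_strand i j \<in> strands D" "anti_strand i j \<in> strands D"
    "main_strand i (Suc j) \<in> strands D" "anti_strand i (Suc j) \<in> strands D"
    using assms by (auto intro: in_strands)
  show "main_down i (Suc j) \<longleftrightarrow> anti_down i j"
    using in_edge_inject[OF s(3,2)] out_edge_inject[OF s(3,2)]
    by (auto simp: ends_main ends_anti split: if_splits)
  show "anti_down i (Suc j) \<longleftrightarrow> main_down i j"
    using in_edge_inject[OF s(4,1)] out_edge_inject[OF s(4,1)]
    by (auto simp: ends_main ends_anti split: if_splits)
qed

text \<open>\<open>Top (prv i)\<close> joins two upper ends, so an oriented strand arrives from
  below at one of them and descends at the other.\<close>

lemma down_top:
  assumes "i \<in> {1..n}"
  shows "main_down i 0 \<longleftrightarrow> \<not> anti_down (prv i) 0"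
proof -
  have s: "main_strand i 0 \<in> strands D" "anti_strand (prv i) 0 \<in> strands D"
    using assms prv_in[OF assms] height_pos by (auto intro!: in_strands)
  have "L i 0 = R (prv i) 0" by (simp add: left_side_def right_side_def)
  then show ?thesis
    using in_edge_inject[OF s] out_edge_inject[OF s]
    by (auto simp: ends_main ends_anti split: if_splits)
qed

lemma side_bottom:
  assumes "i \<in> {1..n}"
  shows "L i (height i) = Bottom (prv i)" "R i (height i) = Bottom i"
  using height_pos[OF assms] by (simp_all add: left_side_def right_side_def height_def)

lemma down_bottom:
  assumes "i \<in> {1..n}"
  shows "anti_down i (height i - 1) \<longleftrightarrow> \<not> main_down (prv i) (height (prv i) - 1)"
proof -
  have s: "anti_strand i (height i - 1) \<in> strands D"
    "main_strand (prv i) (height (prv i) - 1) \<in> strands D"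
    using assms prv_in[OF assms] height_pos by (auto intro!: in_strands)
  have "L i (Suc (height i - 1)) = R (prv i) (Suc (height (prv i) - 1))"
    using side_bottom assms prv_in[OF assms] height_pos[OF assms] height_pos[OF prv_in[OF assms]] by simp
  then show ?thesis
    using in_edge_inject[OF s] out_edge_inject[OF s]
    by (auto simp: ends_main ends_anti split: if_splits)
qed

text \<open>The Alexander numbering of the regions: the index of the region above all columns is 2 and
  \<open>region i\<close> is the index of the region to the right of column \<open>i\<close>.  An edge gets the index
  of the region to its left.\<close>

definition region :: "nat \<Rightarrow> nat" where "region i = (if anti_down i 0 then 1 else 3)"

fun numbering :: "pretzel_edge \<Rightarrow> nat" where
  "numbering (Top i) = region i - of_bool (\<not> anti_down i 0)"
| "numbering (Bottom i) = region i - of_bool (\<not> main_down i (height i - 1))"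
| "numbering (Inner_Left i j) = region (prv i) - of_bool (main_down i j)"
| "numbering (Inner_Right i j) = region i - of_bool (\<not> anti_down i j)"

lemma numbering_right:
  assumes "i \<in> {1..n}" "j < height i"
  shows "numbering (R i j) = region i - of_bool (\<not> anti_down i j)"
    "numbering (R i (Suc j)) = region i - of_bool (\<not> main_down i j)"
proof -
  show "numbering (R i j) = region i - of_bool (\<not> anti_down i j)"
    using assms by (auto simp: right_side_def height_def)
  show "numbering (R i (Suc j)) = region i - of_bool (\<not> main_down i j)"
  proof (cases "Suc j = height i")
    case True
    then show ?thesis using side_bottom[OF assms(1)] True[symmetric] by simp
  next
    case False
    then show ?thesis using assms down_Suc[of i j] by (auto simp: right_side_def height_def)
  qed
qed

text \<open>The outer edges on the left are numbered from column \<open>prv i\<close>;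
  \<open>down_top\<close> and \<open>down_bottom\<close> show that column \<open>i\<close> assigns
  the same index.\<close>

lemma numbering_left:
  assumes "i \<in> {1..n}" "j < height i"
  shows "numbering (L i j) = region (prv i) - of_bool (main_down i j)"
    "numbering (L i (Suc j)) = region (prv i) - of_bool (anti_down i j)"
proof -
  show "numbering (L i j) = region (prv i) - of_bool (main_down i j)"
    using assms down_top[OF assms(1)] by (cases "j = 0") (auto simp: left_side_def height_def)
  show "numbering (L i (Suc j)) = region (prv i) - of_bool (anti_down i j)"
  proof (cases "Suc j = height i")
    case True
    then have "anti_down i j \<longleftrightarrow> \<not> main_down (prv i) (height (prv i) - 1)"
      using down_bottom[OF assms(1)] by (metis diff_Suc_1)
    then show ?thesis using side_bottom[OF assms(1)] True[symmetric] by simp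
  next
    case False
    then show ?thesis using assms down_Suc[of i j] by (auto simp: left_side_def height_def)
  qed
qed

text \<open>Passing through column \<open>i\<close> from left to right crosses both strands; a
  descending one lowers the index by 1, an ascending one raises it by 1. The form with sums avoids
  truncated subtraction.\<close>

lemma region_prv:
  assumes "i \<in> {1..n}" "j < height i"
  shows "region (prv i) + 2 = region i + 2 * of_bool (main_down i j) + 2 * of_bool (anti_down i j)"
  using assms(2)
proof (induction j)
  case 0
  show ?case using down_top[OF assms(1)] by (auto simp: region_def)
next
  case (Suc j)
  then show ?case using down_Suc[OF assms(1), of j] by simp
qed

text \<open>Starting from index 2 keeps every region positive, so the truncated subtractions in
  \<open>numbering\<close> are true ones.\<close>

lemma region_pos: "region i \<ge> 1"
  by (simp add: region_def)

lemma sides_pretzel: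
  "left_edge D \<omega> (i, j) = (if q i > 0 then (if anti_down i j then R i (Suc j) else L i j)
     else (if main_down i j then R i j else L i (Suc j)))"
  "right_edge D \<omega> (i, j) = (if q i > 0 then (if anti_down i j then L i j else R i (Suc j))
     else (if main_down i j then L i (Suc j) else R i j))"
  by (auto simp: left_edge_def right_edge_def strand_pretzel main_down_def anti_down_def
      main_strand_def anti_strand_def)

lemma orient_pretzel:
  "\<omega> ((i, j), Under) \<longleftrightarrow> (if q i > 0 then \<not> main_down i j else \<not> anti_down i j)"
  "\<omega> ((i, j), Over) \<longleftrightarrow> (if q i > 0 then anti_down i j else \<not> main_down i j)"
  by (auto simp: main_down_def anti_down_def main_strand_def anti_strand_def)

lemma alexander_numbering: "alexander_numbering D \<omega> numbering"
  unfolding alexander_numbering_def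
proof
  fix c assume "c \<in> crossings D"
  then obtain i j where c: "c = (i, j)" and i: "i \<in> {1..n}" and j: "j < height i"
    by (auto simp: crossings_pretzel)
  show "numbering (right_edge D \<omega> c) = Suc (numbering (left_edge D \<omega> c)) \<and>
     (if \<omega> (c, Under) = \<omega> (c, Over)
      then numbering (in_edge D \<omega> (c, Over)) = Suc (numbering (left_edge D \<omega> c)) \<and>
           numbering (out_edge D \<omega> (c, Over)) = numbering (left_edge D \<omega> c)
      else numbering (in_edge D \<omega> (c, Over)) = numbering (left_edge D \<omega> c) \<and>
           numbering (out_edge D \<omega> (c, Over)) = Suc (numbering (left_edge D \<omega> c)))"
    using region_prv[OF i j] region_pos[of i] region_pos[of "prv i"]
    unfolding c
    by (cases "q i > 0"; cases "main_down i j"; cases "anti_down i j")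
      (simp_all add: sides_pretzel orient_pretzel in_edge_def out_edge_def strand_pretzel
        numbering_left[OF i j] numbering_right[OF i j])
qed

section \<open>Parallel and antiparallel columns\<close>

lemma down_alternate:
  assumes "i \<in> {1..n}" "j < height i"
  shows "main_down i j \<longleftrightarrow> (if even j then main_down i 0 else anti_down i 0)"
    "anti_down i j \<longleftrightarrow> (if even j then anti_down i 0 else main_down i 0)"
proof -
  have "(main_down i j \<longleftrightarrow> (if even j then main_down i 0 else anti_down i 0)) \<and>
      (anti_down i j \<longleftrightarrow> (if even j then anti_down i 0 else main_down i 0))"
    using assms(2)
  proof (induction j)
    case 0
    then show ?case by simp
  next
    case (Suc j)
    then show ?case using down_Suc[OF assms(1), of j] by auto
  qed
  then show "main_down i j \<longleftrightarrow> (if even j then main_down i 0 else anti_down i 0)"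
    "anti_down i j \<longleftrightarrow> (if even j then anti_down i 0 else main_down i 0)" by auto
qed

lemma even_height: "even (height i) \<longleftrightarrow> even (q i)"
  by (simp add: height_def even_nat_iff)

lemma down_last:
  assumes "i \<in> {1..n}"
  shows "main_down i (height i - 1) \<longleftrightarrow> (if odd (q i) then main_down i 0 else anti_down i 0)"
    "anti_down i (height i - 1) \<longleftrightarrow> (if odd (q i) then anti_down i 0 else main_down i 0)"
proof -
  have "even (height i - 1) \<longleftrightarrow> odd (q i)"
    using height_pos[OF assms] even_height[of i] by auto
  moreover have "height i - 1 < height i" using height_pos[OF assms] by simp
  ultimately show "main_down i (height i - 1) \<longleftrightarrow> (if odd (q i) then main_down i 0 else anti_down i 0)"
    "anti_down i (height i - 1) \<longleftrightarrow> (if odd (q i) then anti_down i 0 else main_down i 0)"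
    using down_alternate[OF assms, of "height i - 1"] by simp_all
qed

text \<open>In a column with an odd number of crossings the last one has the same directions as the
  first, so \<open>Bottom (prv i)\<close> yields a second condition on the top crossings.\<close>

lemma down_odd_odd:
  assumes "i \<in> {1..n}" "odd (q i)" "odd (q (prv i))"
  shows "main_down i 0 \<longleftrightarrow> \<not> anti_down (prv i) 0" "anti_down i 0 \<longleftrightarrow> \<not> main_down (prv i) 0"
  using down_top[OF assms(1)] down_bottom[OF assms(1)] down_last[OF assms(1)]
    down_last[OF prv_in[OF assms(1)]] assms by auto

text \<open>Being parallel passes from a column to the next, with alternating direction. Around an
  odd number of columns this contradicts the closing arc \<open>Top n\<close>, so all columns are
  antiparallel, and then the direction stays constant.\<close>

lemma down_all_odd:
  assumes "odd n" "\<forall>i\<in>{1..n}. odd (q i)" "i \<in> {1..n}"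
  shows "main_down i 0 \<longleftrightarrow> \<not> anti_down i 0" "anti_down i 0 \<longleftrightarrow> anti_down 1 0"
proof -
  have step: "main_down (Suc k) 0 = (\<not> anti_down k 0) \<and> anti_down (Suc k) 0 = (\<not> main_down k 0)"
    if "1 \<le> k" "k < n" for k
    using down_odd_odd[of "Suc k"] that assms(2) by (simp add: prv_Suc)
  have "main_down 1 0 \<longleftrightarrow> \<not> anti_down 1 0"
  proof (rule ccontr)
    assume *: "\<not> (main_down 1 0 \<longleftrightarrow> \<not> anti_down 1 0)"
    have "k \<le> n \<Longrightarrow> main_down k 0 = anti_down k 0 \<and> (anti_down k 0 \<longleftrightarrow> (anti_down 1 0 \<longleftrightarrow> odd k))" if "1 \<le> k" for k
      using that
    proof (induction k rule: dec_induct)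
      case base
      then show ?case using * by auto
    next
      case (step k)
      then show ?case using \<open>\<And>k. 1 \<le> k \<Longrightarrow> k < n \<Longrightarrow> _\<close>[of k] by auto
    qed
    from this[of n] have "anti_down n 0 \<longleftrightarrow> anti_down 1 0" using n \<open>odd n\<close> by auto
    moreover have "main_down 1 0 \<longleftrightarrow> \<not> anti_down n 0"
      using down_top[of 1] n by (simp add: previous_column_def)
    ultimately show False using * by auto
  qed
  have "1 \<le> i" "i \<le> n" using assms(3) by auto
  then have "main_down i 0 = (\<not> anti_down i 0) \<and> anti_down i 0 = anti_down 1 0"
  proof (induction i rule: dec_induct)
    case base
    then show ?case using \<open>main_down 1 0 \<longleftrightarrow> \<not> anti_down 1 0\<close> by simp
  next
    case (step k)
    then show ?case using \<open>\<And>k. 1 \<le> k \<Longrightarrow> k < n \<Longrightarrow> _\<close>[of k] by auto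
  qed
  then show "main_down i 0 \<longleftrightarrow> \<not> anti_down i 0" "anti_down i 0 \<longleftrightarrow> anti_down 1 0" by auto
qed

text \<open>An even column swaps its strands between top and bottom. The two arcs from column 1 to
  column 2 thus make column 2 parallel, which propagates with alternating direction; the arc
  \<open>Top n\<close> then settles the type of column 1.\<close>

lemma down_one_even:
  assumes "even (q 1)" "\<forall>i\<in>{2..n}. odd (q i)"
  shows "\<And>i. i \<in> {2..n} \<Longrightarrow> main_down i 0 = anti_down i 0 \<and> (anti_down i 0 \<longleftrightarrow> (anti_down 1 0 \<longleftrightarrow> odd i))"
    "main_down 1 0 \<longleftrightarrow> (anti_down 1 0 \<longleftrightarrow> even n)"
proof -
  have step: "main_down (Suc k) 0 = (\<not> anti_down k 0) \<and> anti_down (Suc k) 0 = (\<not> main_down k 0)"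
    if "2 \<le> k" "k < n" for k
    using down_odd_odd[of "Suc k"] that assms(2) by (simp add: prv_Suc)
  have two: "main_down 2 0 = (\<not> anti_down 1 0) \<and> anti_down 2 0 = (\<not> anti_down 1 0)" if "2 \<le> n"
  proof -
    have "prv 2 = 1" by (simp add: previous_column_def)
    then show ?thesis
      using down_top[of 2] down_bottom[of 2] down_last[of 2] down_last[of 1] that assms by auto
  qed
  show *: "main_down i 0 = anti_down i 0 \<and> (anti_down i 0 \<longleftrightarrow> (anti_down 1 0 \<longleftrightarrow> odd i))" if "i \<in> {2..n}" for i
  proof -
    have "2 \<le> i" "i \<le> n" using that by auto
    then show ?thesis
    proof (induction i rule: dec_induct)
      case base
      then show ?case using two by auto
    next
      case (step k)
      then show ?case using \<open>\<And>k. 2 \<le> k \<Longrightarrow> k < n \<Longrightarrow> _\<close>[of k] by auto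
    qed
  qed
  have "main_down 1 0 \<longleftrightarrow> \<not> anti_down n 0"
    using down_top[of 1] n by (simp add: previous_column_def)
  then show "main_down 1 0 \<longleftrightarrow> (anti_down 1 0 \<longleftrightarrow> even n)"
    using *[of n] n by (cases "n = 1") auto
qed

end

section \<open>Colourings of pretzel diagrams\<close>

definition laurent_unit :: "'a::field \<Rightarrow> 'a \<Rightarrow> bool" where
  "laurent_unit t x \<longleftrightarrow> (\<exists>j::int. x = t powi j \<or> x = - (t powi j))"

lemma laurent_unit_powi: "laurent_unit t (t powi j)"
  by (auto simp: laurent_unit_def)

lemma laurent_unit_minus_iff: "laurent_unit t (- x) \<longleftrightarrow> laurent_unit t x"
  by (auto simp: laurent_unit_def minus_equation_iff) (metis add.inverse_inverse)+

lemma laurent_unit_simps [simp]: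
  "laurent_unit t 1" "laurent_unit t t" "laurent_unit t (t ^ k)" "laurent_unit t (inverse t)"
  using laurent_unit_powi[of t 0] laurent_unit_powi[of t 1] laurent_unit_powi[of t "int k"]
    laurent_unit_powi[of t "- 1"] by (simp_all add: power_int_minus)

lemma laurent_unit_mult:
  assumes "t \<noteq> 0" "laurent_unit t x" "laurent_unit t y"
  shows "laurent_unit t (x * y)"
proof -
  from assms obtain i j where "x = t powi i \<or> x = - (t powi i)" "y = t powi j \<or> y = - (t powi j)"
    by (auto simp: laurent_unit_def)
  then have "x * y = t powi (i + j) \<or> x * y = - (t powi (i + j))"
    using \<open>t \<noteq> 0\<close> by (auto simp: power_int_add)
  then show ?thesis by (auto simp: laurent_unit_def)
qed

lemma laurent_unit_inverse:
  assumes "laurent_unit t x"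
  shows "laurent_unit t (inverse x)"
proof -
  from assms obtain j where "x = t powi j \<or> x = - (t powi j)" by (auto simp: laurent_unit_def)
  then have "inverse x = t powi (- j) \<or> inverse x = - (t powi (- j))"
    by (auto simp: power_int_minus inverse_minus_eq)
  then show ?thesis by (auto simp: laurent_unit_def)
qed

lemma laurent_unit_prod:
  assumes "t \<noteq> 0" "\<And>i. i \<in> I \<Longrightarrow> laurent_unit t (x i)"
  shows "laurent_unit t (\<Prod>i\<in>I. x i)"
  using assms(2) by (induction I rule: infinite_finite_induct) (auto intro: laurent_unit_mult[OF assms(1)])

lemma laurent_unit_nonzero: "t \<noteq> 0 \<Longrightarrow> laurent_unit t x \<Longrightarrow> x \<noteq> 0"
  by (auto simp: laurent_unit_def)

text \<open>A Wirtinger relation can be solved for either under-edge once \<open>t\<close> is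
  invertible, so the Alexander matrix is mapped to a field.\<close>

locale pretzel_colouring = oriented_pretzel n q \<omega> + hom: comm_ring_hom h
  for n q \<omega> and h :: "int poly \<Rightarrow> 'a::field" +
  assumes t_nonzero: "h t_poly \<noteq> 0"
begin

section \<open>Solving the relations down the columns\<close>

definition t :: 'a where "t = h t_poly"

lemma t_nz: "t \<noteq> 0"
  using t_nonzero by (simp add: t_def)

text \<open>The factor by which right colour minus left colour changes at crossing \<open>j\<close>.
  The under-colour changes its distance from the over-colour by \<open>t\<close> or its inverse and
  moves to the other side, which gives the sign.\<close>

definition ratio :: "nat \<Rightarrow> nat \<Rightarrow> 'a" where
  "ratio i j = - (if (if q i > 0 then anti_down i j else \<not> main_down i j) then t else inverse t)"

definition diff_at :: "nat \<Rightarrow> nat \<Rightarrow> 'a" where "diff_at i j = (\<Prod>k<j. ratio i k)"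

text \<open>The over-strand carries its colour across the column. For \<open>q i > 0\<close> the
  right colour becomes the left one below, so the new difference is added to the right colour;
  otherwise the left colour becomes the right one, so the old difference is lost.\<close>

definition right_at :: "nat \<Rightarrow> nat \<Rightarrow> 'a" where
  "right_at i j = (if q i > 0 then \<Sum>k=1..j. diff_at i k else - (\<Sum>k<j. diff_at i k))"

definition left_at :: "nat \<Rightarrow> nat \<Rightarrow> 'a" where "left_at i j = 1 + right_at i j - diff_at i j"

text \<open>The factors f and g of the overview: the changes of the right and left colours over the
  whole column, in units of the difference at its top.\<close>

definition right_coeff :: "nat \<Rightarrow> 'a" where "right_coeff i = right_at i (height i)"
definition left_coeff :: "nat \<Rightarrow> 'a" where "left_coeff i = left_at i (height i)"

lemma at_0 [simp]: "diff_at i 0 = 1" "right_at i 0 = 0" "left_at i 0 = 0"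
  by (simp_all add: diff_at_def right_at_def left_at_def)

lemma at_Suc:
  "q i > 0 \<Longrightarrow> left_at i (Suc j) = 1 + right_at i j"
  "q i > 0 \<Longrightarrow> right_at i (Suc j) = right_at i j + ratio i j * diff_at i j"
  "\<not> q i > 0 \<Longrightarrow> right_at i (Suc j) = left_at i j - 1"
  "\<not> q i > 0 \<Longrightarrow> left_at i (Suc j) = left_at i j - ratio i j * diff_at i j"
  by (simp_all add: left_at_def right_at_def diff_at_def)

text \<open>The colouring of the edges determined by the colours \<open>\<tau>\<close> of the top edges when the relations
  are solved down the columns; \<open>Bottom i\<close> gets the colour required by column \<open>i\<close>.\<close>

fun colour :: "(nat \<Rightarrow> 'a) \<Rightarrow> pretzel_edge \<Rightarrow> 'a" where
  "colour \<tau> (Top i) = \<tau> i"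
| "colour \<tau> (Bottom i) = \<tau> i + right_coeff i * (\<tau> i - \<tau> (prv i))"
| "colour \<tau> (Inner_Left i j) = \<tau> (prv i) + left_at i j * (\<tau> i - \<tau> (prv i))"
| "colour \<tau> (Inner_Right i j) = \<tau> i + right_at i j * (\<tau> i - \<tau> (prv i))"

lemma colour_right:
  assumes "i \<in> {1..n}" "j \<le> height i"
  shows "colour \<tau> (R i j) = \<tau> i + right_at i j * (\<tau> i - \<tau> (prv i))"
  using assms by (auto simp: right_side_def height_def right_coeff_def)

lemma colour_left:
  assumes "i \<in> {1..n}" "j < height i"
  shows "colour \<tau> (L i j) = \<tau> (prv i) + left_at i j * (\<tau> i - \<tau> (prv i))"
  using assms by (auto simp: left_side_def height_def)

text \<open>The coefficient of the lower left edge in the relation of an anti strand.\<close>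

definition anti_unit :: "nat \<Rightarrow> nat \<Rightarrow> 'a" where
  "anti_unit i j = (if q i > 0 then - 1 else if main_down i j then - t else 1)"

lemma at_diff: "diff_at i j = 1 + right_at i j - left_at i j"
  by (simp add: left_at_def)

lemma defect_main:
  assumes "i \<in> {1..n}" "j < height i"
  shows "colouring_defect t D \<omega> (colour \<tau>) (main_strand i j) = 0"
  using colour_right[OF assms(1) less_imp_le[OF assms(2)], of \<tau>]
    colour_right[OF assms(1) Suc_leI[OF assms(2)], of \<tau>] colour_left[OF assms, of \<tau>] t_nz
  by (cases "q i > 0"; cases "anti_down i j")
    (simp_all add: colouring_defect_def main_strand_def sides_pretzel strand_pretzel at_Suc
      ratio_def at_diff; simp add: field_simps)+

text \<open>The relation fixes the lower left colour. It can fail only at the bottom, where that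
  edge has been coloured from the neighbouring column.\<close>

lemma defect_anti:
  assumes "i \<in> {1..n}" "j < height i"
  shows "colouring_defect t D \<omega> (colour \<tau>) (anti_strand i j) =
    anti_unit i j * (colour \<tau> (L i (Suc j)) - (\<tau> (prv i) + left_at i (Suc j) * (\<tau> i - \<tau> (prv i))))"
  using colour_right[OF assms(1) less_imp_le[OF assms(2)], of \<tau>]
    colour_right[OF assms(1) Suc_leI[OF assms(2)], of \<tau>] colour_left[OF assms, of \<tau>] t_nz
  by (cases "q i > 0"; cases "main_down i j")
    (simp_all add: colouring_defect_def anti_strand_def sides_pretzel strand_pretzel at_Suc
      ratio_def anti_unit_def at_diff; simp add: field_simps)+

lemma defect_anti_inner:
  assumes "i \<in> {1..n}" "Suc j < height i"
  shows "colouring_defect t D \<omega> (colour \<tau>) (anti_strand i j) = 0"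
  using assms colour_left[OF assms] by (simp add: defect_anti)

definition last_strand :: "nat \<Rightarrow> (nat \<times> nat) \<times> level" where
  "last_strand i = anti_strand i (height i - 1)"

text \<open>Column \<open>prv i\<close> colours \<open>Bottom (prv i)\<close> along its right side
  and column \<open>i\<close> demands a colour along its left side; the defect compares the
  two.\<close>

lemma defect_last:
  assumes "i \<in> {1..n}"
  shows "colouring_defect t D \<omega> (colour \<tau>) (last_strand i) =
    anti_unit i (height i - 1) * (right_coeff (prv i) * (\<tau> (prv i) - \<tau> (prv (prv i))) - left_coeff i * (\<tau> i - \<tau> (prv i)))"
proof -
  have "Suc (height i - 1) = height i" "height i - 1 < height i" using height_pos[OF assms] by auto
  then show ?thesis
    using defect_anti[OF assms, of "height i - 1" \<tau>] side_bottom[OF assms]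
    by (simp add: last_strand_def left_coeff_def)
qed

section \<open>Elimination of the edges below the top\<close>

definition lower_end :: "(nat \<times> nat) \<times> level \<Rightarrow> pretzel_edge" where
  "lower_end = (\<lambda>((i, j), l). if (l = Under) = (q i > 0) then R i (Suc j) else L i (Suc j))"

lemma lower_end [simp]:
  "lower_end (main_strand i j) = R i (Suc j)" "lower_end (anti_strand i j) = L i (Suc j)"
  by (simp_all add: lower_end_def main_strand_def anti_strand_def)

text \<open>The last anti strand of a column ends at \<open>Bottom (prv i)\<close>, already the
  lower end of a main strand; its relation therefore stays outside the triangular block.\<close>

definition inner_strands :: "((nat \<times> nat) \<times> level) set" where
  "inner_strands = strands D - last_strand ` {1..n}"

lemma inner_strands_cases:
  assumes "s \<in> inner_strands"
  obtains i j where "i \<in> {1..n}" "j < height i" "s = main_strand i j"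
    | i j where "i \<in> {1..n}" "Suc j < height i" "s = anti_strand i j"
proof -
  have s: "s \<in> strands D" and ns: "s \<notin> last_strand ` {1..n}"
    using assms by (auto simp: inner_strands_def)
  from s show ?thesis
  proof (cases rule: strands_cases)
    case (1 i j)
    then show ?thesis using that by blast
  next
    case (2 i j)
    have "j \<noteq> height i - 1" using ns 2 by (auto simp: last_strand_def)
    then show ?thesis using that(2)[of i j] 2 by simp
  qed
qed

lemma side_inject:
  assumes "i \<in> {1..n}" "i' \<in> {1..n}"
  shows "j \<le> height i \<Longrightarrow> j' < height i' \<Longrightarrow> R i j = R i' (Suc j') \<longleftrightarrow> i = i' \<and> j = Suc j'"
    "j \<le> height i \<Longrightarrow> Suc j' < height i' \<Longrightarrow> R i j \<noteq> L i' (Suc j')"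
    "j \<le> height i \<Longrightarrow> Suc j' < height i' \<Longrightarrow> L i j = L i' (Suc j') \<longleftrightarrow> i = i' \<and> j = Suc j'"
    "j < height i \<Longrightarrow> j' < height i' \<Longrightarrow> L i j \<noteq> R i' (Suc j')"
  by (auto simp: left_side_def right_side_def height_def)

lemma inj_lower_end: "inj_on lower_end inner_strands"
proof (rule inj_onI)
  fix s s' assume s: "s \<in> inner_strands" and s': "s' \<in> inner_strands"
    and eq: "lower_end s = lower_end s'"
  from s show "s = s'"
  proof (cases rule: inner_strands_cases)
    case (1 i j)
    from s' show ?thesis
    proof (cases rule: inner_strands_cases)
      case (1 i' j')
      then show ?thesis
        using eq \<open>s = _\<close> side_inject(1)[OF \<open>i \<in> _\<close> 1(1), of "Suc j" j'] \<open>j < height i\<close> by auto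
    next
      case (2 i' j')
      then show ?thesis
        using eq \<open>s = _\<close> side_inject(2)[OF \<open>i \<in> _\<close> 2(1), of "Suc j" j'] \<open>j < height i\<close> by auto
    qed
  next
    case (2 i j)
    from s' show ?thesis
    proof (cases rule: inner_strands_cases)
      case (1 i' j')
      then show ?thesis
        using eq \<open>s = _\<close> side_inject(4)[OF \<open>i \<in> _\<close> 1(1), of "Suc j" j'] \<open>Suc j < height i\<close> by auto
    next
      case (2 i' j')
      then show ?thesis
        using eq \<open>s = _\<close> side_inject(3)[OF \<open>i \<in> _\<close> 2(1), of "Suc j" j'] \<open>Suc j < height i\<close> by auto
    qed
  qed
qed

lemma main_support:
  assumes "alexander_matrix D \<omega> (main_strand i j) e \<noteq> 0"
  shows "e \<in> {R i j, L i j, R i (Suc j)}"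
proof (rule ccontr)
  assume "e \<notin> {R i j, L i j, R i (Suc j)}"
  then have "alexander_matrix D \<omega> (main_strand i j) e = 0"
    by (cases "q i > 0") (auto simp: main_strand_def alexander_matrix_Over alexander_matrix_Under
        strand_pretzel sides_pretzel)
  with assms show False by simp
qed

lemma anti_support:
  assumes "alexander_matrix D \<omega> (anti_strand i j) e \<noteq> 0"
  shows "e \<in> {R i j, L i j, L i (Suc j)} \<or> \<not> q i > 0 \<and> e = R i (Suc j)"
proof (rule ccontr)
  assume "\<not> (e \<in> {R i j, L i j, L i (Suc j)} \<or> \<not> q i > 0 \<and> e = R i (Suc j))"
  then have "alexander_matrix D \<omega> (anti_strand i j) e = 0"
    by (cases "q i > 0") (auto simp: anti_strand_def alexander_matrix_Over alexander_matrix_Under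
        strand_pretzel sides_pretzel)
  with assms show False by simp
qed

lemma h_pCons [simp]: "h (pCons 0 1) = t"
  by (simp add: t_def one_pCons)

text \<open>The other edges in the relation differ from the lower end, so the entry is the image of
  1, -1 or \<open>- t_poly\<close>.\<close>

lemma inner_diagonal:
  assumes "s \<in> inner_strands"
  shows "laurent_unit t (h (alexander_matrix D \<omega> s (lower_end s)))"
  using assms
proof (cases rule: inner_strands_cases)
  case (1 i j)
  have "R i j \<noteq> R i (Suc j)" "L i j \<noteq> R i (Suc j)"
    using side_inject(1,4)[of i i j j] 1 by auto
  then show ?thesis
    using 1 by (auto simp: main_strand_def alexander_matrix_Over alexander_matrix_Under lower_end_def
        strand_pretzel sides_pretzel laurent_unit_minus_iff hom.hom_uminus
        simp del: minus_pCons simp flip: t_def)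
next
  case (2 i j)
  have "R i j \<noteq> L i (Suc j)" "R i (Suc j) \<noteq> L i (Suc j)"
    using side_inject(2)[of i i j j] side_inject(2)[of i i "Suc j" j] 2 by auto
  then show ?thesis
    using 2 by (auto simp: anti_strand_def alexander_matrix_Over alexander_matrix_Under lower_end_def
        strand_pretzel sides_pretzel laurent_unit_minus_iff hom.hom_uminus
        simp del: minus_pCons simp flip: t_def)
qed

text \<open>At a crossing the over-strand comes first: for negative \<open>q i\<close> the relation
  of the anti strand also involves the lower right edge, the pivot of the over-strand.\<close>

definition depth :: "(nat \<times> nat) \<times> level \<Rightarrow> nat" where
  "depth = (\<lambda>((i, j), l). 2 * j + of_bool (l = Under))"

lemma depth_strand:
  "depth (main_strand i j) = 2 * j + of_bool (q i > 0)"
  "depth (anti_strand i j) = 2 * j + of_bool (\<not> q i > 0)"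
  by (simp_all add: depth_def main_strand_def anti_strand_def)

lemma lower_end_above:
  assumes s': "s' \<in> inner_strands"
    and ij: "i \<in> {1..n}" "j < height i" and eq: "lower_end s' \<in> {R i j, L i j}"
  shows "s' = main_strand i (j - 1) \<and> j > 0 \<or> s' = anti_strand i (j - 1) \<and> j > 0"
  using s'
  proof (cases rule: inner_strands_cases)
    case (1 i' j')
    then have e: "R i' (Suc j') = R i j \<or> R i' (Suc j') = L i j" using eq by simp
    then have "R i j = R i' (Suc j')"
      using side_inject(4)[OF ij(1) 1(1) ij(2) 1(2)] by metis
    then show ?thesis
      using side_inject(1)[OF ij(1) 1(1) less_imp_le[OF ij(2)] 1(2)] 1(3) by simp
  next
    case (2 i' j')
    then have "L i' (Suc j') = R i j \<or> L i' (Suc j') = L i j" using eq by simp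
    then have "L i j = L i' (Suc j')"
      using side_inject(2)[OF ij(1) 2(1) less_imp_le[OF ij(2)] 2(2)] by metis
    then show ?thesis
      using side_inject(3)[OF ij(1) 2(1) less_imp_le[OF ij(2)] 2(2)] 2(3) by simp
  qed

lemma inner_triangular:
  assumes s: "s \<in> inner_strands" and s': "s' \<in> inner_strands"
    and nz: "h (alexander_matrix D \<omega> s (lower_end s')) \<noteq> 0"
  shows "s = s' \<or> depth s' < depth s"
proof -
  from nz have nz: "alexander_matrix D \<omega> s (lower_end s') \<noteq> 0" by (metis hom.hom_zero)
  from s show ?thesis
  proof (cases rule: inner_strands_cases)
    case (1 i j)
    have "lower_end s' \<in> {R i j, L i j} \<or> lower_end s' = lower_end s"
      using main_support[of i j] nz 1(3) by auto
    then show ?thesis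
    proof
      assume "lower_end s' = lower_end s"
      then show ?thesis using inj_lower_end s s' by (auto dest: inj_onD)
    next
      assume "lower_end s' \<in> {R i j, L i j}"
      then show ?thesis using lower_end_above[OF s' 1(1,2)] 1(3) by (auto simp: depth_strand)
    qed
  next
    case (2 i j)
    have "lower_end s' \<in> {R i j, L i j} \<or> \<not> q i > 0 \<and> lower_end s' = lower_end (main_strand i j) \<or> lower_end s' = lower_end s"
      using anti_support[of i j] nz 2(3) by auto
    then show ?thesis
    proof (elim disjE)
      assume "lower_end s' = lower_end s"
      then show ?thesis using inj_lower_end s s' by (auto dest: inj_onD)
    next
      assume "lower_end s' \<in> {R i j, L i j}"
      then show ?thesis using lower_end_above[OF s' 2(1) Suc_lessD[OF 2(2)]] 2(3) by (auto simp: depth_strand)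
    next
      assume *: "\<not> q i > 0 \<and> lower_end s' = lower_end (main_strand i j)"
      have "main_strand i j \<in> inner_strands"
        using 2 by (auto simp: inner_strands_def last_strand_def in_strands)
      then have "s' = main_strand i j" using inj_onD[OF inj_lower_end conjunct2[OF *] s'] by simp
      then show ?thesis using * 2(3) by (auto simp: depth_strand)
    qed
  qed
qed

lemma side_edges:
  assumes "i \<in> {1..n}" "j < height i"
  shows "R i j \<in> edges D" "R i (Suc j) \<in> edges D" "L i j \<in> edges D" "L i (Suc j) \<in> edges D"
proof -
  have c: "(i, j) \<in> crossings D" using assms by (simp add: crossings_pretzel)
  show "R i j \<in> edges D" "R i (Suc j) \<in> edges D" "L i j \<in> edges D" "L i (Suc j) \<in> edges D"
    using strand_edges(1,2)[OF c, of Under] strand_edges(1,2)[OF c, of Over]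
    by (simp_all add: strand_pretzel split: if_splits)
qed

lemma last_strand_eq [simp]: "last_strand i = last_strand i' \<longleftrightarrow> i = i'"
  by (auto simp: last_strand_def)

text \<open>The rows left are those of columns 2 to \<open>n\<close>, the unknowns
  \<open>Top 1\<close> to \<open>Top (n - 1)\<close>. The colour of \<open>Top n\<close> is 0, which
  removes the corner entries of the cyclic system.\<close>

lemma defect_last_basis:
  assumes "m < n - 1" "m' < n - 1"
  shows "colouring_defect t D \<omega> (colour (\<lambda>i. of_bool (i = Suc m'))) (last_strand (m + 2)) =
    tridiagonal (\<lambda>i. anti_unit (i + 2) (height (i + 2) - 1) * (right_coeff (i + 1) + left_coeff (i + 2)))
      (\<lambda>i. - (anti_unit (i + 2) (height (i + 2) - 1) * left_coeff (i + 2)))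
      (\<lambda>i. - (anti_unit (i + 2) (height (i + 2) - 1) * right_coeff (i + 1))) m m'"
proof -
  have "prv (m + 2) = m + 1" using prv_Suc[of "m + 1"] by simp
  \<comment> \<open>For \<open>m = 0\<close> the previous column is \<open>n\<close>, which differs
    from \<open>Suc m'\<close>.\<close>
  moreover have "of_bool (prv (m + 1) = Suc m') = (of_bool (m = Suc m') :: 'a)"
    using assms by (cases m) (auto simp: prv_Suc previous_column_def)
  ultimately show ?thesis
    using assms by (subst defect_last) (auto simp: tridiagonal_def ring_distribs)
qed

text \<open>The minor without the row \<open>last_strand 1\<close> and the column
  \<open>Top n\<close> is evaluated: the inner strands with their lower ends form a triangular block
  with unit pivots, whose Schur complement is the tridiagonal matrix on the top edges.\<close>

theorem alexander_polynomial_chain_sum: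
  "\<exists>c. laurent_unit t c \<and> h (alexander_polynomial D \<omega>) = c * chain_sum right_coeff left_coeff n"
proof -
  let ?A = "alexander_matrix D \<omega>"
  define u where "u m = anti_unit (m + 2) (height (m + 2) - 1)" for m
  have fin: "finite (strands D)" "finite (edges D)"
    by (auto intro: finite_strands finite_edges finite_crossings)
  have card: "card (edges D) = card (strands D)"
    using oriented by (auto simp: orientation_def dest: bij_betw_same_card)
  have last: "last_strand i \<in> strands D" if "i \<in> {1..n}" for i
    using that height_pos[OF that] by (simp add: last_strand_def in_strands)
  obtain rs0 where rs0: "distinct rs0" "set rs0 = inner_strands"
    and det0: "sdet (\<lambda>r c. h (?A r c)) rs0 (map lower_end rs0) = (\<Prod>s\<in>inner_strands. h (?A s (lower_end s)))"
    using sdet_triangular[OF _ inj_lower_end, of "\<lambda>r c. h (?A r c)" depth] inner_triangular fin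
    unfolding inner_strands_def by blast
  define cs0 where "cs0 = map lower_end rs0"
  define rs1 where "rs1 = map (\<lambda>m. last_strand (m + 2)) [0..<n - 1]"
  define cs1 where "cs1 = map (\<lambda>m. Top (Suc m)) [0..<n - 1]"
  \<comment> \<open>Solving the inner relations with top edge \<open>d\<close> coloured 1 and all
    other top edges 0 gives the edge \<open>c\<close> this colour.\<close>
  define X where "X c d = colour (\<lambda>i. of_bool (Top i = d)) c" for c d
  have rs1: "distinct rs1" "set rs1 = last_strand ` {2..n}"
  proof -
    have "{2..n} \<subseteq> (\<lambda>m. m + 2) ` {0..<n - 1}"
    proof
      fix i assume "i \<in> {2..n}"
      then show "i \<in> (\<lambda>m. m + 2) ` {0..<n - 1}" by (intro image_eqI[of _ _ "i - 2"]) auto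
    qed
    then have "{2..n} = (\<lambda>m. m + 2) ` {0..<n - 1}" by auto
    then show "set rs1 = last_strand ` {2..n}" by (simp add: rs1_def image_image)
    show "distinct rs1" by (auto simp: rs1_def distinct_map inj_on_def last_strand_def)
  qed
  have rs: "distinct (rs0 @ rs1)" "set (rs0 @ rs1) = strands D - {last_strand 1}"
  proof -
    have split: "{1..n} = insert 1 {2..n}" using n by auto
    have "last_strand 1 \<notin> last_strand ` {2..n}" by (auto simp: last_strand_def)
    then show "set (rs0 @ rs1) = strands D - {last_strand 1}"
      using last unfolding set_append rs0 rs1 inner_strands_def split by auto
    show "distinct (rs0 @ rs1)"
      using rs0 rs1 unfolding inner_strands_def by auto
  qed
  have len: "length rs0 = length cs0" "length rs1 = length cs1" by (simp_all add: cs0_def rs1_def cs1_def)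
  have len_rs: "length (rs0 @ rs1) = card (edges D) - 1"
    using rs last[of 1] n fin by (metis card card_Diff_singleton distinct_card atLeastAtMost_iff order_refl)
  have top_edge: "Top i \<in> edges D" if "i \<in> {1..n}" for i
    using side_edges(1)[OF that height_pos[OF that]] by (simp add: right_side_def)
  have no_top: "lower_end s \<noteq> Top k" if "s \<in> inner_strands" for s k
    using that by (cases rule: inner_strands_cases) (auto simp: left_side_def right_side_def)
  have low_edge: "lower_end s \<in> edges D" if "s \<in> inner_strands" for s
    using that by (cases rule: inner_strands_cases) (auto simp: side_edges)
  have cs: "distinct (cs0 @ cs1)" "set (cs0 @ cs1) \<subseteq> edges D - {Top n}"
  proof -
    show "distinct (cs0 @ cs1)"
      using rs0 inj_lower_end no_top by (auto simp: cs0_def cs1_def distinct_map inj_on_def)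
    have "set cs0 \<subseteq> edges D - {Top n}"
      using rs0(2) low_edge no_top by (auto simp: cs0_def)
    moreover have "set cs1 \<subseteq> edges D - {Top n}"
      by (auto simp: cs1_def intro!: top_edge)
    ultimately show "set (cs0 @ cs1) \<subseteq> edges D - {Top n}" by simp
  qed
  have len_cs: "length (cs0 @ cs1) = card (edges D) - 1" using len len_rs by simp
  \<comment> \<open>Injectivity of \<open>lower_end\<close> and the count of strands show that no
    edge has been missed.\<close>
  have set_cs: "set (cs0 @ cs1) = edges D - {Top n}"
    using cs len_cs fin top_edge[of n] n
    by (intro card_subset_eq) (auto simp del: set_append simp: distinct_card)
  \<comment> \<open>\<open>Top n\<close> has colour 0 and among \<open>cs1\<close> only
    \<open>d\<close> has colour 1, so the Schur complement entry is the defect of a basis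
    colouring.\<close>
  have elim: "h (?A r d) + (\<Sum>c\<in>set cs0. h (?A r c) * X c d) = colouring_defect t D \<omega> (colour (\<lambda>i. of_bool (Top i = d))) r"
    if r: "r \<in> strands D" and d: "d \<in> set cs1" for r d
  proof -
    from d obtain m where m: "d = Top (Suc m)" "m < n - 1" by (auto simp: cs1_def)
    have "colouring_defect t D \<omega> (colour (\<lambda>i. of_bool (Top i = d))) r = (\<Sum>c\<in>edges D. h (?A r c) * X c d)"
      unfolding X_def t_def
      by (rule sum_alexander_matrix[OF hom.comm_ring_hom_axioms finite_crossings r, symmetric])
    also have "\<dots> = h (?A r (Top n)) * X (Top n) d + (\<Sum>c\<in>set (cs0 @ cs1). h (?A r c) * X c d)"
      unfolding set_cs using fin top_edge[of n] n by (intro sum.remove) auto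
    also have "X (Top n) d = 0" using m by (simp add: X_def)
    also have "(\<Sum>c\<in>set (cs0 @ cs1). h (?A r c) * X c d) =
        (\<Sum>c\<in>set cs0. h (?A r c) * X c d) + (\<Sum>c\<in>set cs1. h (?A r c) * X c d)"
      using cs(1) by (auto intro!: sum.union_disjoint)
    also have "(\<Sum>c\<in>set cs1. h (?A r c) * X c d) = (\<Sum>c\<in>set cs1. if c = d then h (?A r c) else 0)"
      by (intro sum.cong) (auto simp: X_def cs1_def m(1))
    also have "\<dots> = h (?A r d)" using d by simp
    finally show ?thesis by simp
  qed
  have "h (sdet ?A (rs0 @ rs1) (cs0 @ cs1)) = sdet (\<lambda>r c. h (?A r c)) (rs0 @ rs1) (cs0 @ cs1)"
    by (rule sdet_hom[OF hom.comm_ring_hom_axioms])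
  also have "\<dots> = sdet (\<lambda>r c. h (?A r c)) rs0 cs0 *
      sdet (\<lambda>r d. h (?A r d) + (\<Sum>c\<in>set cs0. h (?A r c) * X c d)) rs1 cs1"
  proof (rule sdet_append[OF len])
    show "distinct cs0" using cs by simp
    fix r d assume r: "r \<in> set rs0" and d: "d \<in> set cs1"
    have "r \<in> inner_strands" using r rs0 by simp
    then have "colouring_defect t D \<omega> \<tau> r = 0" if "\<tau> = colour \<sigma>" for \<sigma> \<tau>
      unfolding that by (cases rule: inner_strands_cases) (auto simp: defect_main defect_anti_inner)
    moreover have "r \<in> strands D" using \<open>r \<in> inner_strands\<close> by (simp add: inner_strands_def)
    ultimately show "h (?A r d) + (\<Sum>c\<in>set cs0. h (?A r c) * X c d) = 0"
      using elim d by simp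
  qed
  also have "sdet (\<lambda>r d. h (?A r d) + (\<Sum>c\<in>set cs0. h (?A r c) * X c d)) rs1 cs1 =
      sdet (tridiagonal (\<lambda>i. u i * (right_coeff (i + 1) + left_coeff (i + 2)))
        (\<lambda>i. - (u i * left_coeff (i + 2))) (\<lambda>i. - (u i * right_coeff (i + 1)))) [0..<n - 1] [0..<n - 1]"
  proof -
    have "h (?A (rs1 ! m) (cs1 ! m')) + (\<Sum>c\<in>set cs0. h (?A (rs1 ! m) c) * X c (cs1 ! m')) =
        tridiagonal (\<lambda>i. u i * (right_coeff (i + 1) + left_coeff (i + 2)))
        (\<lambda>i. - (u i * left_coeff (i + 2))) (\<lambda>i. - (u i * right_coeff (i + 1))) m m'"
      if "m < n - 1" "m' < n - 1" for m m'
    proof -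
      have "rs1 ! m \<in> strands D" "cs1 ! m' \<in> set cs1"
        using that rs(2) by (auto simp: rs1_def cs1_def intro!: last)
      from elim[OF this] show ?thesis
        using defect_last_basis[OF that] that by (simp add: rs1_def cs1_def u_def)
    qed
    then show ?thesis
      unfolding sdet_def by (intro arg_cong[of _ _ det] eq_matI) (auto simp: rs1_def)
  qed
  also have "\<dots> = (\<Prod>i<n - 1. u i) * chain_sum right_coeff left_coeff n"
    using n by (subst sdet_chain) simp
  also have "sdet (\<lambda>r c. h (?A r c)) rs0 cs0 = (\<Prod>s\<in>inner_strands. h (?A s (lower_end s)))"
    using det0 by (simp add: cs0_def)
  finally have "h (sdet ?A (rs0 @ rs1) (cs0 @ cs1)) =
      (\<Prod>s\<in>inner_strands. h (?A s (lower_end s))) * (\<Prod>i<n - 1. u i) * chain_sum right_coeff left_coeff n"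
    by (simp add: mult.assoc)
  moreover obtain j where "sdet ?A (rs0 @ rs1) (cs0 @ cs1) = t_poly ^ j * alexander_polynomial D \<omega> \<or>
      sdet ?A (rs0 @ rs1) (cs0 @ cs1) = - (t_poly ^ j) * alexander_polynomial D \<omega>"
    using alexander_polynomial_minor[OF finite_crossings crossings_nonempty oriented alexander_numbering
        rs(1) _ len_rs cs(1) _ len_cs] rs(2) cs(2) by blast
  moreover define w where "w = (\<Prod>s\<in>inner_strands. h (?A s (lower_end s))) * (\<Prod>i<n - 1. u i)"
  ultimately have eq: "w * chain_sum right_coeff left_coeff n = t ^ j * h (alexander_polynomial D \<omega>) \<or>
      w * chain_sum right_coeff left_coeff n = - (t ^ j) * h (alexander_polynomial D \<omega>)"
    by (auto simp only: hom.hom_mult hom.hom_uminus hom.hom_power t_def)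
  have w: "laurent_unit t w"
    unfolding w_def u_def anti_unit_def
    by (auto intro!: laurent_unit_mult laurent_unit_prod inner_diagonal t_nz simp: laurent_unit_minus_iff)
  have "t ^ j \<noteq> 0" using t_nz by simp
  then have "h (alexander_polynomial D \<omega>) = (w * inverse (t ^ j)) * chain_sum right_coeff left_coeff n \<or>
      h (alexander_polynomial D \<omega>) = (- (w * inverse (t ^ j))) * chain_sum right_coeff left_coeff n"
    using eq by (auto simp: field_simps)
  moreover have "laurent_unit t (w * inverse (t ^ j))"
    using w by (intro laurent_unit_mult t_nz laurent_unit_inverse) auto
  ultimately show ?thesis using laurent_unit_minus_iff by blast
qed

text \<open>All crossings of a parallel column have the same ratio, \<open>z\<close> or its inverse
  according to the sign of \<open>q i\<close>, so the colours are geometric sums and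
  \<open>powi\<close> covers both signs.\<close>

lemma parallel_coeff:
  assumes i: "i \<in> {1..n}" and par: "main_down i 0 = anti_down i 0"
    and z: "z = - (if anti_down i 0 then t else inverse t)" "z \<noteq> 1"
  shows "right_coeff i = z * quantum_int (q i) z" "left_coeff i = quantum_int (q i) z"
proof -
  have z0: "z \<noteq> 0" using z t_nz by simp
  have ratio: "ratio i j = (if q i > 0 then z else inverse z)" if "j < height i" for j
    using down_alternate[OF i that] par by (auto simp: ratio_def z inverse_minus_eq)
  have "diff_at i j = (if q i > 0 then z ^ j else inverse z ^ j) \<and> (1 - z) * right_at i j = z * (1 - diff_at i j)"
    if "j \<le> height i" for j
    using that
  proof (induction j)
    case 0
    then show ?case by simp
  next
    case (Suc j)
    then have IH: "diff_at i j = (if q i > 0 then z ^ j else inverse z ^ j)" "(1 - z) * right_at i j = z * (1 - diff_at i j)"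
      and r: "ratio i j = (if q i > 0 then z else inverse z)" using ratio by auto
    have d: "diff_at i (Suc j) = ratio i j * diff_at i j" by (simp add: diff_at_def)
    have "(1 - z) * right_at i (Suc j) = z * (1 - diff_at i (Suc j))"
    proof (cases "q i > 0")
      case True
      then have "(1 - z) * right_at i (Suc j) = (1 - z) * right_at i j + (1 - z) * (z * diff_at i j)"
        using at_Suc(2)[OF True, of j] r by (simp add: algebra_simps)
      then show ?thesis using r True unfolding IH(2) d by (simp add: algebra_simps)
    next
      case False
      then have "(1 - z) * right_at i (Suc j) = (1 - z) * right_at i j - (1 - z) * diff_at i j"
        using at_Suc(3)[OF False, of j] by (simp add: left_at_def flip: right_diff_distrib)
      moreover have "z * diff_at i (Suc j) = diff_at i j" using r False z0 d by simp
      ultimately show ?thesis unfolding IH(2) by (simp add: algebra_simps)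
    qed
    then show ?case using d IH r by simp
  qed
  from this[of "height i"] have d: "diff_at i (height i) = (if q i > 0 then z ^ height i else inverse z ^ height i)"
    and r: "(1 - z) * right_coeff i = z * (1 - diff_at i (height i))" by (auto simp: right_coeff_def)
  have d: "diff_at i (height i) = z powi q i"
    using q[OF i] unfolding d by (auto simp: power_int_def height_def)
  have z1: "1 - z \<noteq> 0" using z(2) by (metis right_minus_eq)
  show R: "right_coeff i = z * quantum_int (q i) z"
    using r z1 unfolding d by (simp add: quantum_int_def field_simps)
  have "left_coeff i = 1 + right_coeff i - z powi q i"
    by (simp add: left_coeff_def left_at_def right_coeff_def d)
  then show "left_coeff i = quantum_int (q i) z"
    using z1 unfolding R by (simp add: quantum_int_def field_simps)
qed

text \<open>The ratios alternate between \<open>- T\<close> and \<open>- inverse T\<close>, so the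
  differences alternate between 1 and \<open>- T\<close>, and two crossings together change the
  colours by \<open>1 - T\<close> up to sign. Doubling treats both parities at once.\<close>

lemma antiparallel_coeff:
  assumes i: "i \<in> {1..n}" and anti: "main_down i 0 = (\<not> anti_down i 0)"
    and T: "T = (if anti_down i 0 then t else inverse t)"
  shows "2 * right_coeff i = of_int (q i) * (1 - T) - (if odd (q i) then 1 + T else 0)"
    "2 * left_coeff i = of_int (q i) * (1 - T) + (if odd (q i) then 1 + T else 0)"
proof -
  have T0: "T \<noteq> 0" using T t_nz by simp
  have ratio: "ratio i j = - (if even j then T else inverse T)" if "j < height i" for j
    using down_alternate[OF i that] anti by (auto simp: ratio_def T)
  have "diff_at i j = (if even j then 1 else - T) \<and>
      2 * right_at i j = (if q i > 0 then of_nat j else - of_nat j) * (1 - T) - (if odd j then 1 + T else 0)"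
    if "j \<le> height i" for j
    using that
  proof (induction j)
    case 0
    then show ?case by simp
  next
    case (Suc j)
    then have IH: "diff_at i j = (if even j then 1 else - T)"
      "2 * right_at i j = (if q i > 0 then of_nat j else - of_nat j) * (1 - T) - (if odd j then 1 + T else 0)"
      and r: "ratio i j = - (if even j then T else inverse T)" using ratio by auto
    have d: "diff_at i (Suc j) = ratio i j * diff_at i j" by (simp add: diff_at_def)
    have d: "diff_at i (Suc j) = (if even (Suc j) then 1 else - T)" using T0 r IH(1) d by simp
    have "2 * right_at i (Suc j) = 2 * right_at i j + (if q i > 0 then 2 * diff_at i (Suc j) else - 2 * diff_at i j)"
      by (simp add: right_at_def)
    then have "2 * right_at i (Suc j) =
        (if q i > 0 then of_nat (Suc j) else - of_nat (Suc j)) * (1 - T) - (if odd (Suc j) then 1 + T else 0)"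
      unfolding IH d by (cases "q i > 0"; cases "even j") (simp_all, simp_all add: algebra_simps)
    then show ?case using d by blast
  qed
  from this[of "height i"] have d: "diff_at i (height i) = (if even (q i) then 1 else - T)"
    and r: "2 * right_coeff i = (if q i > 0 then of_nat (height i) else - of_nat (height i)) * (1 - T) - (if odd (q i) then 1 + T else 0)"
    by (auto simp: right_coeff_def even_height)
  have "(if q i > 0 then of_nat (height i) else - of_nat (height i)) = (of_int (q i) :: 'a)"
    by (simp add: height_def of_nat_nat)
  with r show R: "2 * right_coeff i = of_int (q i) * (1 - T) - (if odd (q i) then 1 + T else 0)" by simp
  have "2 * left_coeff i = 2 + 2 * right_coeff i - 2 * diff_at i (height i)"
    by (simp add: left_coeff_def left_at_def right_coeff_def algebra_simps)
  then show "2 * left_coeff i = of_int (q i) * (1 - T) + (if odd (q i) then 1 + T else 0)"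
    unfolding R d by (cases "odd (q i)") (simp_all add: algebra_simps)
qed

end

section \<open>Evaluation of the determinant\<close>

lemma quantum_int_nonzero:
  fixes x :: "'a::field"
  assumes "x \<noteq> 1" "x powi m \<noteq> 1"
  shows "quantum_int m x \<noteq> 0"
  using assms by (simp add: quantum_int_def)

lemma quantum_int_inverse:
  fixes x :: "'a::field"
  assumes "x \<noteq> 0" "x \<noteq> 1"
  shows "quantum_int m (inverse x) = - x * quantum_int (- m) x"
  using assms by (simp add: quantum_int_def power_int_minus power_int_inverse divide_simps) (simp add: algebra_simps)

lemma quantum_int_minus:
  fixes x :: "'a::field"
  assumes "x \<noteq> 0"
  shows "quantum_int (- m) x = - (x powi (- m)) * quantum_int m x"
proof -
  have "x powi m \<noteq> 0" using assms by simp
  then show ?thesis by (simp add: quantum_int_def power_int_minus divide_simps)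
qed

lemma inverse_quantum_int_minus:
  fixes x :: "'a::field"
  assumes "x \<noteq> 0" "x \<noteq> 1" "x powi m \<noteq> 1"
  shows "1 / quantum_int (- m) x = (1 - x) - 1 / quantum_int m x"
proof -
  define w where "w = x powi m"
  have "w \<noteq> 0" "w \<noteq> 1" using assms by (auto simp: w_def)
  then have "1 - inverse w \<noteq> 0" by (metis eq_iff_diff_eq_0 inverse_1 inverse_inverse_eq)
  then show ?thesis
    using assms \<open>w \<noteq> 0\<close> \<open>w \<noteq> 1\<close>
    by (simp add: quantum_int_def power_int_minus flip: w_def) (simp add: divide_simps, simp add: algebra_simps)
qed

section \<open>Closed forms of the chain sum\<close>

lemma prod_elem_sym:
  fixes a :: "'i \<Rightarrow> 'a::comm_ring_1"
  assumes "finite I"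
  shows "(\<Prod>i\<in>I. a i * r + s) = (\<Sum>j\<le>card I. elem_sym j I a * r ^ j * s ^ (card I - j))"
proof -
  have "(\<Prod>i\<in>I. a i * r + s) = (\<Sum>S\<in>Pow I. (\<Prod>i\<in>S. a i * r) * (\<Prod>i\<in>I - S. s))"
    by (rule prod_add[OF assms])
  also have "\<dots> = (\<Sum>S\<in>Pow I. (\<Prod>i\<in>S. a i) * r ^ card S * s ^ (card I - card S))"
    using assms by (intro sum.cong refl) (auto simp: prod.distrib card_Diff_subset finite_subset)
  also have "\<dots> = (\<Sum>j\<le>card I. \<Sum>S | S \<in> Pow I \<and> card S = j. (\<Prod>i\<in>S. a i) * r ^ card S * s ^ (card I - card S))"
    using assms by (intro sum.group[symmetric]) (auto simp: card_mono)
  also have "\<dots> = (\<Sum>j\<le>card I. elem_sym j I a * r ^ j * s ^ (card I - j))"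
    by (intro sum.cong refl) (simp add: elem_sym_def sum_distrib_right)
  finally show ?thesis .
qed

lemma of_int_elem_sym:
  "(of_int (elem_sym k I q) :: 'a::comm_ring_1) = elem_sym k I (\<lambda>i. of_int (q i))"
  by (simp add: elem_sym_def)

text \<open>Writing \<open>c\<close> as \<open>g k - f k\<close> in the summand that omits column
  \<open>k\<close> makes the sum telescope.\<close>

lemma chain_sum_telescope:
  fixes f g :: "nat \<Rightarrow> 'a::comm_ring_1"
  assumes "\<And>i. i \<in> {1..n} \<Longrightarrow> g i - f i = c"
  shows "c * chain_sum f g n = (\<Prod>i=1..n. g i) - (\<Prod>i=1..n. f i)"
  using assms
proof (induction n)
  case 0
  then show ?case by simp
next
  case (Suc n)
  have c: "f (Suc n) = g (Suc n) - c" using Suc.prems[of "Suc n"] by (simp add: algebra_simps)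
  have "c * chain_sum f g (Suc n) = g (Suc n) * (c * chain_sum f g n) + c * (\<Prod>i=1..n. f i)"
    by (simp add: algebra_simps)
  also have "c * chain_sum f g n = (\<Prod>i=1..n. g i) - (\<Prod>i=1..n. f i)" using Suc by simp
  finally show ?case by (simp add: c algebra_simps)
qed

text \<open>Telescoping leaves two products that differ by the sign of \<open>s\<close>. For odd
  \<open>n\<close> only elementary symmetric polynomials of even index survive in their difference,
  each twice; cancelling \<open>2 * s\<close> leaves the denominator
  \<open>2 ^ (n - 1)\<close>.\<close>

lemma chain_sum_odd_symmetric:
  fixes f g :: "nat \<Rightarrow> 'a::field_char_0"
  assumes "odd n" and s: "s \<noteq> 0"
    and f: "\<And>i. i \<in> {1..n} \<Longrightarrow> 2 * f i = of_int (q i) * r - s"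
    and g: "\<And>i. i \<in> {1..n} \<Longrightarrow> 2 * g i = of_int (q i) * r + s"
  shows "chain_sum f g n =
    1 / 2 ^ (n - 1) * (\<Sum>k | 2 * k \<le> n - 1. r ^ (2 * k) * s ^ (n - 1 - 2 * k) * of_int (elem_sym (2 * k) {1..n} q))"
proof -
  have "g i - f i = s" if "i \<in> {1..n}" for i
  proof -
    have "2 * (g i - f i) = 2 * s"
      using f[OF that] g[OF that] by (simp add: algebra_simps)
    then show ?thesis by (metis mult_left_cancel zero_neq_numeral)
  qed
  then have "s * chain_sum f g n = (\<Prod>i=1..n. g i) - (\<Prod>i=1..n. f i)"
    by (rule chain_sum_telescope)
  then have "2 ^ n * (s * chain_sum f g n) = (\<Prod>i=1..n. 2 * g i) - (\<Prod>i=1..n. 2 * f i)"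
    by (simp add: prod.distrib right_diff_distrib)
  also have "(\<Prod>i=1..n. 2 * g i) = (\<Prod>i=1..n. of_int (q i) * r + s)"
    using g by (intro prod.cong) auto
  also have "(\<Prod>i=1..n. 2 * f i) = (\<Prod>i=1..n. of_int (q i) * r + - s)"
    using f by (intro prod.cong) auto
  also have "(\<Prod>i=1..n. of_int (q i) * r + s) - (\<Prod>i=1..n. of_int (q i) * r + - s) =
      (\<Sum>j\<le>n. of_int (elem_sym j {1..n} q) * r ^ j * (s ^ (n - j) - (- s) ^ (n - j)))"
    unfolding prod_elem_sym[OF finite_atLeastAtMost]
    by (simp add: of_int_elem_sym sum_subtractf right_diff_distrib)
  also have "\<dots> = (\<Sum>j\<in>(*) 2 ` {k. 2 * k \<le> n - 1}. of_int (elem_sym j {1..n} q) * r ^ j * (s ^ (n - j) - (- s) ^ (n - j)))"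
  proof (intro sum.mono_neutral_right ballI)
    fix j assume j: "j \<in> {..n} - (*) 2 ` {k. 2 * k \<le> n - 1}"
    have "odd j"
    proof
      assume "even j"
      then obtain k where k: "j = 2 * k" by blast
      with j \<open>odd n\<close> have "2 * k \<le> n - 1" by (cases "2 * k = n") auto
      with j k show False by auto
    qed
    then have "even (n - j)" using \<open>odd n\<close> j by auto
    then show "of_int (elem_sym j {1..n} q) * r ^ j * (s ^ (n - j) - (- s) ^ (n - j)) = 0" by simp
  qed auto
  also have "\<dots> = (\<Sum>k | 2 * k \<le> n - 1. 2 * s * (r ^ (2 * k) * s ^ (n - 1 - 2 * k) * of_int (elem_sym (2 * k) {1..n} q)))"
  proof (subst sum.reindex)
    show "inj_on ((*) 2) {k::nat. 2 * k \<le> n - 1}" by (auto simp: inj_on_def)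
    have "of_int (elem_sym (2 * k) {1..n} q) * r ^ (2 * k) * (s ^ (n - 2 * k) - (- s) ^ (n - 2 * k)) =
        2 * s * (r ^ (2 * k) * s ^ (n - 1 - 2 * k) * of_int (elem_sym (2 * k) {1..n} q))"
      if "2 * k \<le> n - 1" for k
    proof -
      have n: "n - 2 * k = Suc (n - 1 - 2 * k)" using that odd_pos[OF \<open>odd n\<close>] by simp
      have "odd (n - 2 * k)" using \<open>odd n\<close> that by auto
      then have "(- s) ^ (n - 2 * k) = - (s ^ (n - 2 * k))" by simp
      then show ?thesis by (simp add: n del: power_Suc) (simp add: algebra_simps)
    qed
    then show "sum ((\<lambda>j. of_int (elem_sym j {1..n} q) * r ^ j * (s ^ (n - j) - (- s) ^ (n - j))) \<circ> (*) 2) {k. 2 * k \<le> n - 1} =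
        (\<Sum>k | 2 * k \<le> n - 1. 2 * s * (r ^ (2 * k) * s ^ (n - 1 - 2 * k) * of_int (elem_sym (2 * k) {1..n} q)))"
      by (intro sum.cong) auto
  qed
  also have "\<dots> = 2 * s * (\<Sum>k | 2 * k \<le> n - 1. r ^ (2 * k) * s ^ (n - 1 - 2 * k) * of_int (elem_sym (2 * k) {1..n} q))"
    by (simp add: sum_distrib_left)
  also have "(2::'a) ^ n = 2 * 2 ^ (n - 1)"
    using odd_pos[OF \<open>odd n\<close>] by (simp flip: power_Suc)
  finally show ?thesis using s by (simp add: field_simps)
qed

text \<open>In each pair of columns \<open>f\<close> and \<open>g\<close> have the same product
  \<open>- y * d i * e i\<close>. So, after multiplication by \<open>y\<close>, omitting a column
  turns the full product into its multiple by \<open>1 / e i\<close> or \<open>- 1 / d i\<close>.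
  The product of \<open>f\<close> is carried along because it enters the recursion.\<close>

lemma chain_sum_pairs_even:
  fixes f g :: "nat \<Rightarrow> 'a::field"
  assumes "\<And>i. i \<in> {1..p} \<Longrightarrow> f (2 * i) = y * e i \<and> g (2 * i) = e i \<and> e i \<noteq> 0"
    and "\<And>i. i \<in> {1..p} \<Longrightarrow> f (2 * i - 1) = - d i \<and> g (2 * i - 1) = - y * d i \<and> d i \<noteq> 0"
  shows "y * chain_sum f g (2 * p) = (- y) ^ p * ((\<Prod>i=1..p. d i) * (\<Prod>i=1..p. e i)) *
      ((\<Sum>i=1..p. 1 / e i) - (\<Sum>i=1..p. 1 / d i)) \<and>
    (\<Prod>i=1..2 * p. f i) = (- y) ^ p * ((\<Prod>i=1..p. d i) * (\<Prod>i=1..p. e i))"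
  using assms
proof (induction p)
  case 0
  then show ?case by simp
next
  case (Suc p)
  have f: "f (Suc (Suc (2 * p))) = y * e (Suc p)" "g (Suc (Suc (2 * p))) = e (Suc p)"
    "f (Suc (2 * p)) = - d (Suc p)" "g (Suc (2 * p)) = - y * d (Suc p)"
    and nz: "e (Suc p) \<noteq> 0" "d (Suc p) \<noteq> 0"
    using Suc.prems(1)[of "Suc p"] Suc.prems(2)[of "Suc p"] by auto
  define A where "A = (\<Prod>i=1..p. d i) * (\<Prod>i=1..p. e i)"
  define S where "S = (\<Sum>i=1..p. 1 / e i) - (\<Sum>i=1..p. 1 / d i)"
  have IH: "y * chain_sum f g (2 * p) = (- y) ^ p * A * S" "(\<Prod>i=1..2 * p. f i) = (- y) ^ p * A"
    using Suc unfolding A_def S_def by auto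
  have A: "(\<Prod>i=1..Suc p. d i) * (\<Prod>i=1..Suc p. e i) = A * (d (Suc p) * e (Suc p))"
    by (simp add: A_def algebra_simps)
  have S: "(\<Sum>i=1..Suc p. 1 / e i) - (\<Sum>i=1..Suc p. 1 / d i) = S + 1 / e (Suc p) - 1 / d (Suc p)"
    by (simp add: S_def)
  have prod: "(\<Prod>i=1..2 * Suc p. f i) = (\<Prod>i=1..2 * p. f i) * (- d (Suc p)) * (y * e (Suc p))"
    by (simp add: f)
  have "y * chain_sum f g (2 * Suc p) = e (Suc p) * (- y * d (Suc p) * (y * chain_sum f g (2 * p)) + y * (\<Prod>i=1..2 * p. f i))
      + y * (\<Prod>i=1..2 * p. f i) * (- d (Suc p))"
    by (simp add: f) (simp add: algebra_simps)
  also have "\<dots> = (- y) ^ Suc p * (A * (d (Suc p) * e (Suc p))) * (S + 1 / e (Suc p) - 1 / d (Suc p))"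
    unfolding IH using nz by (simp add: field_simps)
  finally show ?case
    unfolding A S prod IH by (simp add: algebra_simps)
qed

text \<open>As for an even number of columns, but column 1 stays unpaired: omitting it gives the
  summand 1 in the bracket, every other summand contains \<open>\<phi>\<close>.\<close>

lemma chain_sum_pairs_odd:
  fixes f g :: "nat \<Rightarrow> 'a::field"
  assumes "f 1 = \<phi>"
    and "\<And>i. i \<in> {1..p} \<Longrightarrow> f (2 * i) = y * e i \<and> g (2 * i) = e i \<and> e i \<noteq> 0"
    and "\<And>i. i \<in> {1..p} \<Longrightarrow> f (2 * i + 1) = - d i \<and> g (2 * i + 1) = - y * d i \<and> d i \<noteq> 0"
  shows "chain_sum f g (2 * p + 1) = (- y) ^ p * ((\<Prod>i=1..p. d i) * (\<Prod>i=1..p. e i)) *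
      (1 + \<phi> * ((\<Sum>i=1..p. 1 / e i) - (\<Sum>i=1..p. 1 / d i))) \<and>
    (\<Prod>i=1..2 * p + 1. f i) = \<phi> * (- y) ^ p * ((\<Prod>i=1..p. d i) * (\<Prod>i=1..p. e i))"
  using assms
proof (induction p)
  case 0
  then show ?case by simp
next
  case (Suc p)
  have f: "f (Suc (Suc (2 * p))) = y * e (Suc p)" "g (Suc (Suc (2 * p))) = e (Suc p)"
    "f (Suc (Suc (Suc (2 * p)))) = - d (Suc p)" "g (Suc (Suc (Suc (2 * p)))) = - y * d (Suc p)"
    and nz: "e (Suc p) \<noteq> 0" "d (Suc p) \<noteq> 0"
    using Suc.prems(2)[of "Suc p"] Suc.prems(3)[of "Suc p"] by auto
  define A where "A = (\<Prod>i=1..p. d i) * (\<Prod>i=1..p. e i)"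
  define S where "S = (\<Sum>i=1..p. 1 / e i) - (\<Sum>i=1..p. 1 / d i)"
  have IH: "chain_sum f g (2 * p + 1) = (- y) ^ p * A * (1 + \<phi> * S)" "(\<Prod>i=1..2 * p + 1. f i) = \<phi> * (- y) ^ p * A"
    using Suc unfolding A_def S_def by auto
  have A: "(\<Prod>i=1..Suc p. d i) * (\<Prod>i=1..Suc p. e i) = A * (d (Suc p) * e (Suc p))"
    by (simp add: A_def algebra_simps)
  have S: "(\<Sum>i=1..Suc p. 1 / e i) - (\<Sum>i=1..Suc p. 1 / d i) = S + 1 / e (Suc p) - 1 / d (Suc p)"
    by (simp add: S_def)
  have prod: "(\<Prod>i=1..2 * Suc p + 1. f i) = (\<Prod>i=1..2 * p + 1. f i) * (- d (Suc p)) * (y * e (Suc p))"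
    by (simp add: f)
  have "chain_sum f g (2 * Suc p + 1) = - y * d (Suc p) * (e (Suc p) * chain_sum f g (2 * p + 1) + (\<Prod>i=1..2 * p + 1. f i))
      + (\<Prod>i=1..2 * p + 1. f i) * (y * e (Suc p))"
    by (simp add: f)
  also have "\<dots> = (- y) ^ Suc p * (A * (d (Suc p) * e (Suc p))) * (1 + \<phi> * (S + 1 / e (Suc p) - 1 / d (Suc p)))"
    unfolding IH using nz by (simp add: field_simps)
  finally show ?case
    unfolding A S prod IH by (simp add: algebra_simps)
qed

lemma laurent_unit_neg_powi: "laurent_unit t ((- t) powi m)"
  by (auto simp: laurent_unit_def power_int_minus_left)

lemma quantum_int_inverse_unit:
  fixes x :: "'a::field"
  assumes "x \<noteq> 0" "x \<noteq> 1"
  shows "quantum_int m (inverse x) = (x * x powi (- m)) * quantum_int m x"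
  using quantum_int_inverse[OF assms, of m] quantum_int_minus[OF assms(1), of m] by simp

lemma inverse_quantum_int_inverse:
  fixes x :: "'a::field"
  assumes "x \<noteq> 0" "x \<noteq> 1" "x powi m \<noteq> 1"
  shows "1 / quantum_int m (inverse x) = inverse x * (1 / quantum_int m x - (1 - x))"
proof -
  have "1 / quantum_int m (inverse x) = - inverse x * (1 / quantum_int (- m) x)"
    unfolding quantum_int_inverse[OF assms(1,2)] by (simp add: divide_simps)
  then show ?thesis
    unfolding inverse_quantum_int_minus[OF assms] by (simp add: algebra_simps)
qed

text \<open>Replacing \<open>t\<close> by its inverse, i.e. reversing the orientation, changes the expressions below only
  by units: the constants \<open>1 - x\<close> cancel as there are as many \<open>a i\<close> as \<open>b i\<close>.\<close>

lemma reverse_orientation: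
  fixes t :: "'a::field" and a b :: "nat \<Rightarrow> int" and y :: 'a
  assumes t: "t \<noteq> 0" and neg_t_powi: "\<And>m::int. m \<noteq> 0 \<Longrightarrow> (- t) powi m \<noteq> 1" and fin: "finite I"
    and nz: "\<And>i. i \<in> I \<Longrightarrow> a i \<noteq> 0" "\<And>i. i \<in> I \<Longrightarrow> b i \<noteq> 0"
    and y: "y = - t \<or> y = inverse (- t)"
  defines "A \<equiv> \<lambda>y. (\<Prod>i\<in>I. quantum_int (- a i) y) * (\<Prod>i\<in>I. quantum_int (b i) y)"
    and "S \<equiv> \<lambda>y. (\<Sum>i\<in>I. 1 / quantum_int (b i) y) - (\<Sum>i\<in>I. 1 / quantum_int (- a i) y)"
  shows "\<exists>u. laurent_unit t u \<and> A y = u * A (- t)"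
    "S y = (if y = - t then 1 else inverse (- t)) * S (- t)"
proof -
  have x: "- t \<noteq> 0" "- t \<noteq> 1" using t neg_t_powi[of 1] by auto
  have "\<exists>u. laurent_unit t u \<and> A (inverse (- t)) = u * A (- t)"
  proof (intro exI conjI)
    show "A (inverse (- t)) = ((\<Prod>i\<in>I. - t * (- t) powi a i) * (\<Prod>i\<in>I. - t * (- t) powi (- b i))) * A (- t)"
      unfolding A_def quantum_int_inverse_unit[OF x] by (simp only: prod.distrib minus_minus ac_simps)
    show "laurent_unit t ((\<Prod>i\<in>I. - t * (- t) powi a i) * (\<Prod>i\<in>I. - t * (- t) powi (- b i)))"
      using t by (intro laurent_unit_mult laurent_unit_prod laurent_unit_neg_powi)
        (auto simp: laurent_unit_minus_iff)
  qed
  moreover have "\<exists>u. laurent_unit t u \<and> A (- t) = u * A (- t)" by (intro exI[of _ 1]) simp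
  ultimately show "\<exists>u. laurent_unit t u \<and> A y = u * A (- t)" using y by auto
  have "S (inverse (- t)) = inverse (- t) * S (- t)"
  proof -
    have "(\<Sum>i\<in>I. 1 / quantum_int (b i) (inverse (- t))) =
        inverse (- t) * (\<Sum>i\<in>I. 1 / quantum_int (b i) (- t) - (1 - - t))"
      unfolding sum_distrib_left using nz neg_t_powi by (intro sum.cong refl inverse_quantum_int_inverse x) auto
    moreover have "(\<Sum>i\<in>I. 1 / quantum_int (- a i) (inverse (- t))) =
        inverse (- t) * (\<Sum>i\<in>I. 1 / quantum_int (- a i) (- t) - (1 - - t))"
      unfolding sum_distrib_left using nz neg_t_powi by (intro sum.cong refl inverse_quantum_int_inverse x) auto
    ultimately show ?thesis
      unfolding S_def sum_subtractf right_diff_distrib by simp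
  qed
  then show "S y = (if y = - t then 1 else inverse (- t)) * S (- t)" using y by auto
qed

text \<open>As \<open>- t\<close> is not a root of unity, every quantum integer of nonzero index is
  invertible; characteristic 0 permits division by 2 and by \<open>q 1\<close>.\<close>

locale pretzel_ratfun = pretzel_colouring n q \<omega> h
  for n q \<omega> and h :: "int poly \<Rightarrow> 'a::field_char_0" +
  assumes transcendental: "\<And>m::int. m \<noteq> 0 \<Longrightarrow> (- h t_poly) powi m \<noteq> 1"
begin

lemma neg_t_powi: "m \<noteq> 0 \<Longrightarrow> (- t) powi m \<noteq> 1"
  using transcendental by (simp add: t_def)

lemma x_ne_1: "- t \<noteq> 1" "inverse (- t) \<noteq> 1" "t \<noteq> - 1"
proof -
  show "- t \<noteq> 1" using neg_t_powi[of 1] by simp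
  then show "t \<noteq> - 1" by (metis minus_minus)
  show "inverse (- t) \<noteq> 1" using \<open>- t \<noteq> 1\<close> by (metis inverse_1 inverse_inverse_eq)
qed

text \<open>The eigenvalue of the differences of colours along a parallel column: it is \<open>Y\<close> in the
  columns of even number and \<open>inverse Y\<close> in the others.\<close>

definition Y :: 'a where "Y = (if anti_down 1 0 then inverse (- t) else - t)"

lemma Y: "Y \<noteq> 0" "Y \<noteq> 1" "inverse Y \<noteq> 1" "m \<noteq> 0 \<Longrightarrow> Y powi m \<noteq> 1"
proof -
  show "Y \<noteq> 0" "Y \<noteq> 1" "inverse Y \<noteq> 1"
    using t_nz x_ne_1 by (simp_all add: Y_def del: inverse_minus_eq)
  have "inverse (- t) powi m = inverse ((- t) powi m)" by (rule power_int_inverse)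
  then show "Y powi m \<noteq> 1" if "m \<noteq> 0"
    using neg_t_powi[OF that] by (auto simp: Y_def simp del: inverse_minus_eq)
qed

lemma Y_cases: "Y = - t \<or> Y = inverse (- t)"
  by (auto simp: Y_def)

lemma Y_unit: "laurent_unit t Y" "laurent_unit t (- Y)"
  by (auto simp: Y_def laurent_unit_minus_iff inverse_minus_eq)

lemma unit_transfer:
  assumes "chain_sum right_coeff left_coeff n = u * F" "laurent_unit t u"
  shows "\<exists>v. laurent_unit t v \<and> h (alexander_polynomial D \<omega>) = v * F"
proof -
  obtain c where c: "laurent_unit t c" "h (alexander_polynomial D \<omega>) = c * chain_sum right_coeff left_coeff n"
    using alexander_polynomial_chain_sum by blast
  show ?thesis
    by (intro exI[of _ "c * u"] conjI laurent_unit_mult t_nz c assms(2)) (simp add: c assms(1))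
qed

text \<open>All columns are antiparallel with the same \<open>T\<close>. For
  \<open>T = inverse t\<close> a factor \<open>w\<close> comes out of each of the
  \<open>n - 1\<close> factors of every summand.\<close>

theorem alexander_all_odd:
  assumes "odd n" "\<forall>i\<in>{1..n}. odd (q i)"
  shows "\<exists>u. laurent_unit t u \<and> h (alexander_polynomial D \<omega>) = u * (1 / 2 ^ (n - 1) *
    (\<Sum>k | 2 * k \<le> n - 1. (t - 1) ^ (2 * k) * (t + 1) ^ (n - 1 - 2 * k) * of_int (elem_sym (2 * k) {1..n} q)))"
proof -
  define T where "T = (if anti_down 1 0 then t else inverse t)"
  define w where "w = (if anti_down 1 0 then 1 else inverse t)"
  have w: "laurent_unit t w" by (simp add: w_def)
  \<comment> \<open>\<open>1 - T\<close> is \<open>w * (t - 1)\<close> only up to sign, but it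
    occurs only in even powers.\<close>
  have sq: "(1 - T) ^ (2 * k) = (w * (t - 1)) ^ (2 * k)" for k
  proof -
    have "1 - T = w * (t - 1) \<or> 1 - T = - (w * (t - 1))"
      using t_nz by (auto simp: T_def w_def field_simps)
    then have "(1 - T)\<^sup>2 = (w * (t - 1))\<^sup>2" by auto
    then show ?thesis by (simp add: power_mult)
  qed
  have s: "1 + T = w * (t + 1)" using t_nz by (simp add: T_def w_def field_simps)
  have "t + 1 \<noteq> 0" using x_ne_1(3) by (metis add_eq_0_iff2)
  then have "1 + T \<noteq> 0" unfolding s using laurent_unit_nonzero[OF t_nz w] by simp
  moreover have "2 * right_coeff i = of_int (q i) * (1 - T) - (1 + T)"
    "2 * left_coeff i = of_int (q i) * (1 - T) + (1 + T)" if "i \<in> {1..n}" for i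
  proof -
    have "T = (if anti_down i 0 then t else inverse t)"
      using down_all_odd(2)[OF assms that] by (simp add: T_def)
    from antiparallel_coeff[OF that down_all_odd(1)[OF assms that] this] assms(2) that
    show "2 * right_coeff i = of_int (q i) * (1 - T) - (1 + T)"
      "2 * left_coeff i = of_int (q i) * (1 - T) + (1 + T)" by auto
  qed
  ultimately have "chain_sum right_coeff left_coeff n = 1 / 2 ^ (n - 1) *
      (\<Sum>k | 2 * k \<le> n - 1. (1 - T) ^ (2 * k) * (1 + T) ^ (n - 1 - 2 * k) * of_int (elem_sym (2 * k) {1..n} q))"
    by (rule chain_sum_odd_symmetric[OF assms(1)])
  also have "(\<Sum>k | 2 * k \<le> n - 1. (1 - T) ^ (2 * k) * (1 + T) ^ (n - 1 - 2 * k) * of_int (elem_sym (2 * k) {1..n} q)) =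
      (\<Sum>k | 2 * k \<le> n - 1. w ^ (n - 1) * ((t - 1) ^ (2 * k) * (t + 1) ^ (n - 1 - 2 * k) * of_int (elem_sym (2 * k) {1..n} q)))"
  proof (intro sum.cong refl)
    fix k assume "k \<in> {k. 2 * k \<le> n - 1}"
    then have "2 * k + (n - 1 - 2 * k) = n - 1" by simp
    then have "w ^ (n - 1) = w ^ (2 * k) * w ^ (n - 1 - 2 * k)" by (metis power_add)
    then show "(1 - T) ^ (2 * k) * (1 + T) ^ (n - 1 - 2 * k) * of_int (elem_sym (2 * k) {1..n} q) =
        w ^ (n - 1) * ((t - 1) ^ (2 * k) * (t + 1) ^ (n - 1 - 2 * k) * of_int (elem_sym (2 * k) {1..n} q))"
      unfolding sq s power_mult_distrib by (simp only: ac_simps)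
  qed
  finally have "chain_sum right_coeff left_coeff n = w ^ (n - 1) * (1 / 2 ^ (n - 1) *
      (\<Sum>k | 2 * k \<le> n - 1. (t - 1) ^ (2 * k) * (t + 1) ^ (n - 1 - 2 * k) * of_int (elem_sym (2 * k) {1..n} q)))"
    by (simp add: sum_distrib_left mult.left_commute flip: sum_distrib_left)
  moreover have "laurent_unit t (w ^ (n - 1))"
    using laurent_unit_prod[OF t_nz, of "{..<n - 1}" "\<lambda>_. w"] w by simp
  ultimately show ?thesis by (rule unit_transfer)
qed

text \<open>Alternating directions make the eigenvalue \<open>Y\<close> in even and
  \<open>inverse Y\<close> in odd columns. Rewriting the latter in terms of \<open>Y\<close> is what
  negates \<open>q i\<close> there.\<close>

lemma parallel_coeff_Y:
  assumes "i \<in> {1..n}" "main_down i 0 = anti_down i 0" "anti_down i 0 \<longleftrightarrow> (anti_down 1 0 \<longleftrightarrow> odd i)"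
  shows "even i \<Longrightarrow> right_coeff i = Y * quantum_int (q i) Y \<and> left_coeff i = quantum_int (q i) Y \<and> quantum_int (q i) Y \<noteq> 0"
    "odd i \<Longrightarrow> right_coeff i = - quantum_int (- q i) Y \<and> left_coeff i = - Y * quantum_int (- q i) Y \<and> quantum_int (- q i) Y \<noteq> 0"
proof -
  have "q i \<noteq> 0" using q assms(1) by blast
  then have nz: "quantum_int (q i) Y \<noteq> 0" "quantum_int (- q i) Y \<noteq> 0"
    using quantum_int_nonzero[OF Y(2) Y(4)] by simp_all
  show "right_coeff i = Y * quantum_int (q i) Y \<and> left_coeff i = quantum_int (q i) Y \<and> quantum_int (q i) Y \<noteq> 0"
    if "even i"
  proof -
    have "Y = - (if anti_down i 0 then t else inverse t)"
      using assms(3) that by (auto simp: Y_def inverse_minus_eq)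
    from parallel_coeff[OF assms(1,2) this Y(2)] nz show ?thesis by simp
  qed
  show "right_coeff i = - quantum_int (- q i) Y \<and> left_coeff i = - Y * quantum_int (- q i) Y \<and> quantum_int (- q i) Y \<noteq> 0"
    if "odd i"
  proof -
    have "inverse Y = - (if anti_down i 0 then t else inverse t)"
      using assms(3) that by (auto simp: Y_def inverse_minus_eq)
    from parallel_coeff[OF assms(1,2) this Y(3)] nz show ?thesis
      using Y(1) by (simp add: quantum_int_inverse[OF Y(1,2)])
  qed
qed

text \<open>For even \<open>n\<close> column 1 is parallel too, so the columns pair up as
  \<open>2 * i - 1\<close> and \<open>2 * i\<close>.\<close>

theorem alexander_even_length:
  assumes "n = 2 * p" "even (q 1)" "\<forall>i\<in>{2..n}. odd (q i)"
  shows "\<exists>u. laurent_unit t u \<and> h (alexander_polynomial D \<omega>) = u *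
    (((\<Prod>i=1..p. quantum_int (- q (2 * i - 1)) (- t)) * (\<Prod>i=1..p. quantum_int (q (2 * i)) (- t))) *
     ((\<Sum>i=1..p. 1 / quantum_int (q (2 * i)) (- t)) - (\<Sum>i=1..p. 1 / quantum_int (- q (2 * i - 1)) (- t))))"
proof -
  have par: "main_down i 0 = anti_down i 0 \<and> (anti_down i 0 \<longleftrightarrow> (anti_down 1 0 \<longleftrightarrow> odd i))" if "i \<in> {1..n}" for i
    using down_one_even[OF assms(2,3)] that assms(1) by (cases "i = 1") auto
  have nz: "q (2 * i - 1) \<noteq> 0" "q (2 * i) \<noteq> 0" if "i \<in> {1..p}" for i
    using that assms(1) by (auto intro!: q)
  let ?e = "\<lambda>i. quantum_int (q (2 * i)) Y" and ?d = "\<lambda>i. quantum_int (- q (2 * i - 1)) Y"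
  let ?A = "\<lambda>y. (\<Prod>i=1..p. quantum_int (- q (2 * i - 1)) y) * (\<Prod>i=1..p. quantum_int (q (2 * i)) y)"
  let ?S = "\<lambda>y. (\<Sum>i=1..p. 1 / quantum_int (q (2 * i)) y) - (\<Sum>i=1..p. 1 / quantum_int (- q (2 * i - 1)) y)"
  have "Y * chain_sum right_coeff left_coeff (2 * p) = (- Y) ^ p * ?A Y * ?S Y"
  proof (rule conjunct1[OF chain_sum_pairs_even])
    fix i assume "i \<in> {1..p}"
    then have i: "2 * i \<in> {1..n}" "2 * i - 1 \<in> {1..n}" "odd (2 * i - 1)" using assms(1) by auto
    show "right_coeff (2 * i) = Y * ?e i \<and> left_coeff (2 * i) = ?e i \<and> ?e i \<noteq> 0"
      using parallel_coeff_Y(1)[OF i(1)] par[OF i(1)] by simp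
    show "right_coeff (2 * i - 1) = - ?d i \<and> left_coeff (2 * i - 1) = - Y * ?d i \<and> ?d i \<noteq> 0"
      using parallel_coeff_Y(2)[OF i(2)] par[OF i(2)] i(3) by blast
  qed
  moreover have rev: "\<exists>u. laurent_unit t u \<and> ?A Y = u * ?A (- t)"
    and S: "?S Y = (if Y = - t then 1 else inverse (- t)) * ?S (- t)"
    by (rule reverse_orientation[where t = t and y = Y and I = "{1..p}" and a = "\<lambda>i. q (2 * i - 1)"
          and b = "\<lambda>i. q (2 * i)", OF t_nz _ finite_atLeastAtMost _ _ Y_cases]; erule neg_t_powi nz)+
  moreover obtain u where u: "laurent_unit t u" "?A Y = u * ?A (- t)" using rev by blast
  ultimately have "Y * chain_sum right_coeff left_coeff n =
      ((- Y) ^ p * u * (if Y = - t then 1 else inverse (- t))) * (?A (- t) * ?S (- t))"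
    unfolding assms(1) u S by (simp only: ac_simps)
  then have "chain_sum right_coeff left_coeff n =
      (inverse Y * ((- Y) ^ p * u * (if Y = - t then 1 else inverse (- t)))) * (?A (- t) * ?S (- t))"
    using Y(1) by (simp add: field_simps)
  moreover have "laurent_unit t ((- Y) ^ p)"
    using laurent_unit_prod[OF t_nz, of "{..<p}" "\<lambda>_. - Y"] Y_unit by simp
  then have "laurent_unit t (inverse Y * ((- Y) ^ p * u * (if Y = - t then 1 else inverse (- t))))"
    using u Y_unit by (intro laurent_unit_mult t_nz laurent_unit_inverse) (auto simp: inverse_minus_eq laurent_unit_minus_iff)
  ultimately show ?thesis by (rule unit_transfer)
qed

text \<open>For odd \<open>n\<close> column 1 is antiparallel and contributes \<open>\<phi>\<close>;
  the others pair up as \<open>2 * i\<close> and \<open>2 * i + 1\<close>.\<close>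

theorem alexander_odd_length:
  assumes "n = 2 * p + 1" "even (q 1)" "\<forall>i\<in>{2..n}. odd (q i)"
  shows "\<exists>u. laurent_unit t u \<and> h (alexander_polynomial D \<omega>) = u *
    ((of_int (q 1) / 2 * quantum_int (- 2) (- t) *
       (\<Prod>i=2..p + 1. quantum_int (- q (2 * i - 1)) (- t)) * (\<Prod>i=1..p. quantum_int (q (2 * i)) (- t))) *
     ((\<Sum>i=1..p. 1 / quantum_int (q (2 * i)) (- t)) - (\<Sum>i=2..p + 1. 1 / quantum_int (- q (2 * i - 1)) (- t))
       + 2 / of_int (q 1) * (1 / (t * quantum_int (- 2) (- t)))))"
proof -
  define T where "T = (if anti_down 1 0 then t else inverse t)"
  define \<phi> where "\<phi> = of_int (q 1) / 2 * (1 - T)"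
  have one: "1 \<in> {1..n}" using n by simp
  have anti: "main_down 1 0 = (\<not> anti_down 1 0)" using down_one_even(2)[OF assms(2,3)] assms(1) by simp
  have "2 * right_coeff 1 = of_int (q 1) * (1 - T)" "2 * left_coeff 1 = of_int (q 1) * (1 - T)"
    using antiparallel_coeff[OF one anti T_def] assms(2) by auto
  then have "2 * right_coeff 1 = 2 * \<phi>" by (simp add: \<phi>_def)
  then have \<phi>: "right_coeff 1 = \<phi>" by (metis mult_left_cancel zero_neq_numeral)
  have par: "main_down i 0 = anti_down i 0 \<and> (anti_down i 0 \<longleftrightarrow> (anti_down 1 0 \<longleftrightarrow> odd i))" if "i \<in> {2..n}" for i
    using down_one_even(1)[OF assms(2,3)] that by blast
  have nz: "q (2 * i + 1) \<noteq> 0" "q (2 * i) \<noteq> 0" if "i \<in> {1..p}" for i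
    using that assms(1) by (auto intro!: q)
  let ?e = "\<lambda>i. quantum_int (q (2 * i)) Y" and ?d = "\<lambda>i. quantum_int (- q (2 * i + 1)) Y"
  let ?A = "\<lambda>y. (\<Prod>i=1..p. quantum_int (- q (2 * i + 1)) y) * (\<Prod>i=1..p. quantum_int (q (2 * i)) y)"
  let ?S = "\<lambda>y. (\<Sum>i=1..p. 1 / quantum_int (q (2 * i)) y) - (\<Sum>i=1..p. 1 / quantum_int (- q (2 * i + 1)) y)"
  have chain: "chain_sum right_coeff left_coeff (2 * p + 1) = (- Y) ^ p * ?A Y * (1 + \<phi> * ?S Y)"
  proof (rule conjunct1[OF chain_sum_pairs_odd[where f = right_coeff and \<phi> = \<phi>, OF \<phi>]])
    fix i assume "i \<in> {1..p}"
    then have i: "2 * i \<in> {2..n}" "2 * i + 1 \<in> {2..n}" "2 * i \<in> {1..n}" "2 * i + 1 \<in> {1..n}" using assms(1) by auto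
    show "right_coeff (2 * i) = Y * ?e i \<and> left_coeff (2 * i) = ?e i \<and> ?e i \<noteq> 0"
      using parallel_coeff_Y(1)[OF i(3)] par[OF i(1)] by simp
    show "right_coeff (2 * i + 1) = - ?d i \<and> left_coeff (2 * i + 1) = - Y * ?d i \<and> ?d i \<noteq> 0"
      using parallel_coeff_Y(2)[OF i(4)] par[OF i(2)] by simp
  qed
  have rev: "\<exists>u. laurent_unit t u \<and> ?A Y = u * ?A (- t)"
    and S: "?S Y = (if Y = - t then 1 else inverse (- t)) * ?S (- t)"
    by (rule reverse_orientation[where t = t and y = Y and I = "{1..p}" and a = "\<lambda>i. q (2 * i + 1)"
          and b = "\<lambda>i. q (2 * i)", OF t_nz _ finite_atLeastAtMost _ _ Y_cases]; erule neg_t_powi nz)+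
  obtain u where u: "laurent_unit t u" "?A Y = u * ?A (- t)" using rev by blast
  \<comment> \<open>This identity is the source of the quantum integer of index -2 in the
    formula.\<close>
  have two: "t * quantum_int (- 2) (- t) = 1 - inverse t"
    using t_nz x_ne_1(1,3)
    by (simp add: quantum_int_def power_int_minus divide_simps add_eq_0_iff2) (simp add: power2_eq_square algebra_simps)
  \<comment> \<open>Reversing the orientation replaces \<open>T\<close> by its inverse and also
    changes the factor from \<open>reverse_orientation\<close>; the product is the same in both
    cases.\<close>
  have twist: "(1 - T) * (if Y = - t then 1 else inverse (- t)) = t * quantum_int (- 2) (- t)"
    unfolding two using t_nz
    by (cases "anti_down 1 0"; cases "Y = - t") (auto simp: T_def Y_def field_simps)
  define Q where "Q = quantum_int (- 2) (- t)"
  have "t \<noteq> 1" using neg_t_powi[of 2] by auto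
  then have "t * Q \<noteq> 0" unfolding Q_def two by (metis inverse_1 inverse_inverse_eq right_minus_eq)
  then have Q: "Q \<noteq> 0" by simp
  have q1: "of_int (q 1) \<noteq> (0 :: 'a)" using q[OF one] by simp
  have "1 + \<phi> * ?S Y = 1 + of_int (q 1) / 2 * ((1 - T) * (if Y = - t then 1 else inverse (- t))) * ?S (- t)"
    unfolding S \<phi>_def by (simp only: ac_simps)
  also have "\<dots> = t * (of_int (q 1) / 2 * Q * (?S (- t) + 2 / of_int (q 1) * (1 / (t * Q))))"
    unfolding twist Q_def[symmetric] using q1 Q t_nz by (simp add: field_simps)
  finally have defect: "1 + \<phi> * ?S Y = t * (of_int (q 1) / 2 * Q * (?S (- t) + 2 / of_int (q 1) * (1 / (t * Q))))" .
  have "chain_sum right_coeff left_coeff n =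
      ((- Y) ^ p * u * t) * ((of_int (q 1) / 2 * Q * (\<Prod>i=1..p. quantum_int (- q (2 * i + 1)) (- t)) *
        (\<Prod>i=1..p. quantum_int (q (2 * i)) (- t))) * (?S (- t) + 2 / of_int (q 1) * (1 / (t * Q))))"
    unfolding assms(1) chain defect u by (simp only: ac_simps)
  moreover have "laurent_unit t ((- Y) ^ p)"
    using laurent_unit_prod[OF t_nz, of "{..<p}" "\<lambda>_. - Y"] Y_unit by simp
  then have "laurent_unit t ((- Y) ^ p * u * t)"
    using u by (intro laurent_unit_mult t_nz) auto
  ultimately have "\<exists>v. laurent_unit t v \<and> h (alexander_polynomial D \<omega>) = v *
      ((of_int (q 1) / 2 * Q * (\<Prod>i=1..p. quantum_int (- q (2 * i + 1)) (- t)) *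
        (\<Prod>i=1..p. quantum_int (q (2 * i)) (- t))) * (?S (- t) + 2 / of_int (q 1) * (1 / (t * Q))))"
    by (rule unit_transfer)
  moreover have "(\<Prod>i=2..p + 1. quantum_int (- q (2 * i - 1)) (- t)) = (\<Prod>i=1..p. quantum_int (- q (2 * i + 1)) (- t))"
    using prod.shift_bounds_cl_Suc_ivl[of "\<lambda>i. quantum_int (- q (2 * i - 1)) (- t)" 1 p] by (simp add: numeral_2_eq_2)
  moreover have "(\<Sum>i=2..p + 1. 1 / quantum_int (- q (2 * i - 1)) (- t)) = (\<Sum>i=1..p. 1 / quantum_int (- q (2 * i + 1)) (- t))"
    using sum.shift_bounds_cl_Suc_ivl[of "\<lambda>i. 1 / quantum_int (- q (2 * i - 1)) (- t)" 1 p] by (simp add: numeral_2_eq_2)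
  ultimately show ?thesis by (simp only: Q_def)
qed

end

section \<open>Specialization to rational functions\<close>

lemma comm_ring_hom_ratfun: "comm_ring_hom ratfun_of_int_poly"
proof -
  have "map_poly rat_of_int (p + p') = map_poly of_int p + map_poly of_int p'"
    and "map_poly rat_of_int (p * p') = map_poly of_int p * map_poly of_int p'" for p p'
    by (auto intro!: poly_eqI simp: coeff_map_poly coeff_mult)
  then show ?thesis
    unfolding ratfun_of_int_poly_def by unfold_locales simp_all
qed

lemma ratfun_t_poly: "ratfun_of_int_poly t_poly = ratfun_t"
proof -
  have "map_poly rat_of_int t_poly = [:0, 1:]"
    by (intro poly_eqI) (simp add: coeff_map_poly coeff_pCons split: nat.split)
  then show ?thesis by (simp add: ratfun_of_int_poly_def ratfun_t_def)
qed

text \<open>A positive power of \<open>- t\<close> comes from a polynomial of positive degree;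
  negative exponents follow by inversion.\<close>

lemma ratfun_t_transcendental:
  assumes "m \<noteq> 0"
  shows "(- ratfun_t) powi m \<noteq> 1"
proof -
  have to_fract_power: "to_fract (p ^ k) = to_fract p ^ k" for p :: "rat poly" and k
    by (induction k) simp_all
  have pow: "(- ratfun_t) ^ k \<noteq> 1" if "k > 0" for k
  proof
    assume "(- ratfun_t) ^ k = 1"
    then have "to_fract ([:0, - 1:] ^ k) = (to_fract 1 :: rat poly fract)"
      by (simp add: ratfun_t_def to_fract_power flip: to_fract_uminus)
    then have "degree ([:0, - 1 :: rat:] ^ k) = 0" by (simp only: to_fract_eq_iff degree_1)
    then show False using that by (simp add: degree_power_eq)
  qed
  show ?thesis
  proof (cases m rule: int_cases2)
    case (nonneg k)
    then show ?thesis using pow[of k] assms by simp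
  next
    case (nonpos k)
    then have "(- ratfun_t) powi m = inverse ((- ratfun_t) ^ k)" by (metis power_int_minus power_int_of_nat)
    then show ?thesis using pow[of k] assms nonpos by (metis inverse_1 inverse_inverse_eq neq0_conv of_nat_0 neg_0_equal_iff_equal)
  qed
qed

lemma laurent_unit_eq_up_to_unit:
  "\<exists>u. laurent_unit ratfun_t u \<and> f = u * g \<Longrightarrow> eq_up_to_unit f g"
  by (auto simp: laurent_unit_def eq_up_to_unit_def)

theorem theorem4:
  fixes n :: nat and q :: "nat \<Rightarrow> int" and \<omega> :: "(nat \<times> nat) \<times> level \<Rightarrow> bool"
  assumes n: "n \<ge> 1"
    and nonzero: "\<And>i. i \<in> {1..n} \<Longrightarrow> q i \<noteq> 0"
    and knot: "knot_diagram (pretzel n q)"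
    and oriented: "orientation (pretzel n q) \<omega>"
  shows
    "let \<Delta> = ratfun_of_int_poly (alexander_polynomial (pretzel n q) \<omega>);
         t = ratfun_t;
         br = (\<lambda>m. quantum_int m (- t))
     in
      (odd n \<and> (\<forall>i\<in>{1..n}. odd (q i)) \<longrightarrow>
        eq_up_to_unit \<Delta>
         (1 / 2 ^ (n - 1) *
          (\<Sum>k | 2 * k \<le> n - 1.
             (t - 1) ^ (2 * k) * (t + 1) ^ (n - 1 - 2 * k) * of_int (elem_sym (2 * k) {1..n} q))))
    \<and> (\<forall>p. n = 2 * p \<and> even (q 1) \<and> (\<forall>i\<in>{2..n}. odd (q i)) \<longrightarrow>
        eq_up_to_unit \<Delta>
         (((\<Prod>i=1..p. br (- q (2 * i - 1))) * (\<Prod>i=1..p. br (q (2 * i)))) *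
          ((\<Sum>i=1..p. 1 / br (q (2 * i))) - (\<Sum>i=1..p. 1 / br (- q (2 * i - 1))))))
    \<and> (\<forall>p. n = 2 * p + 1 \<and> even (q 1) \<and> (\<forall>i\<in>{2..n}. odd (q i)) \<longrightarrow>
        eq_up_to_unit \<Delta>
         ((of_int (q 1) / 2 * br (- 2) *
            (\<Prod>i=2..p + 1. br (- q (2 * i - 1))) * (\<Prod>i=1..p. br (q (2 * i)))) *
          ((\<Sum>i=1..p. 1 / br (q (2 * i))) - (\<Sum>i=2..p + 1. 1 / br (- q (2 * i - 1)))
           + 2 / of_int (q 1) * (1 / (t * br (- 2))))))"
proof -
  have "ratfun_t \<noteq> 0" by (simp add: ratfun_t_def)
  then interpret pretzel_ratfun n q \<omega> ratfun_of_int_poly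
    using n nonzero oriented ratfun_t_transcendental
    by (intro pretzel_ratfun.intro pretzel_colouring.intro oriented_pretzel.intro comm_ring_hom_ratfun
        pretzel_colouring_axioms.intro pretzel_ratfun_axioms.intro) (simp_all add: ratfun_t_poly)
  have t: "t = ratfun_t" by (simp add: t_def ratfun_t_poly)
  show ?thesis
    unfolding Let_def
    by (intro conjI impI allI laurent_unit_eq_up_to_unit; elim conjE)
      (rule alexander_all_odd[unfolded t] alexander_even_length[unfolded t] alexander_odd_length[unfolded t];
        assumption)+
qed

end
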